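(* Let $\mathcal H$ be a complex Hilbert space with $\dim \mathcal H=2$ and orthonormal basis $\{|0\rangle,|1\rangle\}$. Let $\mathsf A,\mathsf A'$ be two-outcome measurements on qubit channels $B(\mathcal H)\to B(\mathcal H)$, given by PPOVMs $\{F_{\mathsf A},F_{\mathsf A}^\perp\}$ and $\{F_{\mathsf A'},F_{\mathsf A'}^\perp\}$ on $\mathcal H_{out}\otimes\mathcal H_{in}$. Then $\mathsf A,\mathsf A'$ are maximally incompatible if and only if, up to unitary conjugation on the input and output spaces (i.e. after simultaneously conjugating all four operators by $U_{out}\otimes U_{in}$ for some unitaries $U_{out},U_{in}$ on $\mathcal H$), $$F_{\mathsf A}=|00\rangle\langle00|,\quad F_{\mathsf A}^\perp=|10\rangle\langle10|,\quad F_{\mathsf A'}=|\eta_0\rangle\langle\eta_0|\otimes|1\rangle\langle1|,\quad F_{\mathsf A'}^\perp=|\eta_1\rangle\langle\eta_1|\otimes|1\rangle\langle1|,$$ where $\{|\eta_0\rangle,|\eta_1\rangle\}$ is an orthonormal basis of $\mathcal H$. Moreover, in this case there is a unique witness square for $\mathsf A,\mathsf A'$, and (after the same unitary conjugation) the Choi matrices of its elements are $$C_{ij}=\begin{pmatrix}|i\oplus1\rangle\langle i\oplus1|&0\\0&|\eta_{j\oplus1}\rangle\langle\eta_{j\oplus1}|\end{pmatrix}=|i\oplus 1\rangle\langle i\oplus 1|\otimes|0\rangle\langle0|+|\eta_{j\oplus1}\rangle\langle\eta_{j\oplus1}|\otimes|1\rangle\langle1|,\qquad i,j\in\{0,1\},$$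 where $\oplus$ is addition modulo $2$.
   Context: **Channels as a state space.** A channel is a completely positive trace preserving linear map $B(\mathcal H)\to B(\mathcal H)$. The set $K=\mathcal C(\mathcal H)$ of channels is compact and convex, and is identified via Choi matrices $C(\Phi)=(\Phi\otimes\mathrm{id})(|\psi^+\rangle\langle\psi^+|)$, $|\psi^+\rangle=|00\rangle+|11\rangle$, with $\{C\in B(\mathcal H_{out}\otimes\mathcal H_{in}):C\ge0,\ \mathrm{Tr}_{out}(C)=\mathbb 1\}$ (the first tensor factor is the output, the second the input). Here $|ij\rangle=|i\rangle\otimes|j\rangle$, and block matrices are written with respect to the basis $|0\rangle,|1\rangle$ of the input space, with blocks in $B(\mathcal H_{out})$. **Measurements.** A two-outcome measurement on channels (outcomes $1,-1$) is given by a PPOVM $\{F,F^\perp\}$: positive operators on $\mathcal H_{out}\otimes\mathcal H_{in}$ with $F+F^\perp=\mathbb 1\otimes\sigma$ for some density operator $\sigma$ on $\mathcal H_{in}$. The outcome probabilities on $\Phi$ are $f(\Phi)=\mathrm{Tr}(C(\Phi)F)$ for outcome $1$ and $\mathrm{Tr}(C(\Phi)F^\perp)=1-f(\Phi)$ for outcome $-1$. Every affine function $f:K\to[0,1]$ (effect on channels) is of this form. **Maximal incompatibility.** Let $K$ be a compact convex set and $E(K)$ the set of affine functions $K\to[0,1]$ (effects). Measurements given by $f,f'\in E(K)$ are compatible if there is $p\in E(K)$ with $p\le f$, $p\le f'$, $f+f'\le1+p$ pointwise. Their degree of compatibility is the supremum of $\lambda\in[0,1]$ such that for some constants $\mu,\mu'\in[0,1]$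 the effects $\lambda f+(1-\lambda)\mu$ and $\lambda f'+(1-\lambda)\mu'$ are compatible; it is always $\ge1/2$, and the measurements are maximally incompatible if it equals $1/2$. A witness square for $f,f'$ is a family $x_{00},x_{10},x_{01},x_{11}\in K$ with $\frac12(x_{00}+x_{11})=\frac12(x_{10}+x_{01})$, $f(x_{ij})=i$ and $f'(x_{ij})=j$ for $i,j\in\{0,1\}$. It is known that $f,f'$ are maximally incompatible if and only if a witness square exists. *)

theory Defs
  imports "HOL-Analysis.Analysis" "HOL-Library.Complex_Order"
begin

section \<open>Effects, compatibility and witness squares on a convex set\<close>

definition effects :: "'a::real_vector set \<Rightarrow> ('a \<Rightarrow> real) set" where
  "effects K = {f. (\<forall>x\<in>K. 0 \<le> f x \<and> f x \<le> 1) \<and>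
     (\<forall>x\<in>K. \<forall>y\<in>K. \<forall>t\<in>{0..1}. f ((1 - t) *\<^sub>R x + t *\<^sub>R y) = (1 - t) * f x + t * f y)}"

definition compatible :: "'a::real_vector set \<Rightarrow> ('a \<Rightarrow> real) \<Rightarrow> ('a \<Rightarrow> real) \<Rightarrow> bool" where
  "compatible K f f' \<longleftrightarrow>
     (\<exists>p\<in>effects K. \<forall>x\<in>K. p x \<le> f x \<and> p x \<le> f' x \<and> f x + f' x \<le> 1 + p x)"

definition compatibility_degree :: "'a::real_vector set \<Rightarrow> ('a \<Rightarrow> real) \<Rightarrow> ('a \<Rightarrow> real) \<Rightarrow> real" where
  "compatibility_degree K f f' = Sup {t \<in> {0..1}. \<exists>\<mu>\<in>{0..1}. \<exists>\<mu>'\<in>{0..1}.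
     compatible K (\<lambda>x. t * f x + (1 - t) * \<mu>) (\<lambda>x. t * f' x + (1 - t) * \<mu>')}"

definition maximally_incompatible :: "'a::real_vector set \<Rightarrow> ('a \<Rightarrow> real) \<Rightarrow> ('a \<Rightarrow> real) \<Rightarrow> bool" where
  "maximally_incompatible K f f' \<longleftrightarrow> compatibility_degree K f f' = 1 / 2"

text \<open>Indices in \<open>{0, 1}\<close> are elements of the two-element type \<open>2\<close>, whose addition is addition
  modulo 2.\<close>

definition witness_square ::
  "'a::real_vector set \<Rightarrow> ('a \<Rightarrow> real) \<Rightarrow> ('a \<Rightarrow> real) \<Rightarrow> (2 \<Rightarrow> 2 \<Rightarrow> 'a) \<Rightarrow> bool" where
  "witness_square K f f' x \<longleftrightarrow>
     (\<forall>i j. x i j \<in> K) \<and>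
     (1 / 2) *\<^sub>R (x 0 0 + x 1 1) = (1 / 2) *\<^sub>R (x 1 0 + x 0 1) \<and>
     (\<forall>i j. f (x i j) = of_bool (i = 1) \<and> f' (x i j) = of_bool (j = 1))"


section \<open>Complex vectors and matrices\<close>

definition cinner :: "complex^'n::finite \<Rightarrow> complex^'n \<Rightarrow> complex" where
  "cinner v w = (\<Sum>i\<in>UNIV. cnj (v $ i) * w $ i)"

definition cadjoint :: "complex^'n^'m \<Rightarrow> complex^'m^'n" where
  "cadjoint A = (\<chi> i j. cnj (A $ j $ i))"

definition mscale :: "complex \<Rightarrow> complex^'n^'m \<Rightarrow> complex^'n^'m" where
  "mscale c A = (\<chi> i j. c * A $ i $ j)"

definition ket :: "'n \<Rightarrow> complex^'n::finite" where
  "ket i = axis i 1"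

definition ketbra :: "complex^'m \<Rightarrow> complex^'n \<Rightarrow> complex^'n^'m" where
  "ketbra v w = (\<chi> i j. v $ i * cnj (w $ j))"

abbreviation proj :: "complex^'n \<Rightarrow> complex^'n^'n" where
  "proj v \<equiv> ketbra v v"

definition kron_vec :: "complex^'m \<Rightarrow> complex^'n \<Rightarrow> complex^('m \<times> 'n)" where
  "kron_vec v w = (\<chi> p. v $ fst p * w $ snd p)"

definition kron :: "complex^'m^'m \<Rightarrow> complex^'n^'n \<Rightarrow> complex^('m \<times> 'n)^('m \<times> 'n)" where
  "kron A B = (\<chi> p q. A $ fst p $ fst q * B $ snd p $ snd q)"

definition orthonormal_basis :: "('n \<Rightarrow> complex^'n::finite) \<Rightarrow> bool" where
  "orthonormal_basis \<eta> \<longleftrightarrow> (\<forall>i j. cinner (\<eta> i) (\<eta> j) = of_bool (i = j)) \<and>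
     (\<forall>v. \<exists>c. v = (\<Sum>i\<in>UNIV. c i *s \<eta> i))"

definition unitary :: "complex^'n^'n::finite \<Rightarrow> bool" where
  "unitary U \<longleftrightarrow> U ** cadjoint U = mat 1 \<and> cadjoint U ** U = mat 1"

definition conjugate_by :: "complex^'n^'n::finite \<Rightarrow> complex^'n^'n \<Rightarrow> complex^'n^'n" where
  "conjugate_by U A = U ** A ** cadjoint U"

text \<open>In the order of \<open>Complex_Order\<close>, \<open>0 \<le> z\<close> says that \<open>z\<close> is real and nonnegative; in particular
  the operators below are Hermitian.\<close>

definition psd :: "complex^'n^'n::finite \<Rightarrow> bool" where
  "psd A \<longleftrightarrow> (\<forall>v. 0 \<le> cinner v (A *v v))"

definition density :: "complex^'n^'n::finite \<Rightarrow> bool" where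
  "density \<rho> \<longleftrightarrow> psd \<rho> \<and> trace \<rho> = 1"


section \<open>Channels and measurements on channels\<close>

text \<open>A \<open>k \<times> k\<close> block matrix with blocks \<open>X i j\<close> for \<open>i, j < k\<close> represents an operator on the tensor
  product with a \<open>k\<close>-dimensional ancilla; the ampliation of a map acts blockwise. Indexing the blocks
  by naturals lets the dimension of the ancilla be quantified over.\<close>

definition block_psd :: "nat \<Rightarrow> (nat \<Rightarrow> nat \<Rightarrow> complex^'n^'n::finite) \<Rightarrow> bool" where
  "block_psd k X \<longleftrightarrow> (\<forall>v. 0 \<le> (\<Sum>i<k. \<Sum>j<k. cinner (v i) (X i j *v v j)))"

definition completely_positive :: "(complex^'n^'n::finite \<Rightarrow> complex^'m^'m::finite) \<Rightarrow> bool" where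
  "completely_positive \<Phi> \<longleftrightarrow>
     (\<forall>k X. block_psd k X \<longrightarrow> block_psd k (\<lambda>i j. \<Phi> (X i j)))"

definition trace_preserving :: "(complex^'n^'n::finite \<Rightarrow> complex^'m^'m::finite) \<Rightarrow> bool" where
  "trace_preserving \<Phi> \<longleftrightarrow> (\<forall>A. trace (\<Phi> A) = trace A)"

text \<open>In finite dimension every linear map is bounded, so the real vector space of bounded
  (real-)linear maps contains all channels; complex linearity is imposed separately.\<close>

definition channels :: "((complex^'n^'n::finite) \<Rightarrow>\<^sub>L (complex^'m^'m::finite)) set" where
  "channels = {\<Phi>. Vector_Spaces.linear mscale mscale (blinfun_apply \<Phi>) \<and>
     completely_positive (blinfun_apply \<Phi>) \<and> trace_preserving (blinfun_apply \<Phi>)}"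

text \<open>\<open>ampliate \<Phi>\<close> is the map usually written as the tensor product of \<open>\<Phi>\<close> with the identity.\<close>

definition ampliate ::
  "(complex^'n^'n::finite \<Rightarrow> complex^'m^'m::finite) \<Rightarrow>
     complex^('n \<times> 'k::finite)^('n \<times> 'k) \<Rightarrow> complex^('m \<times> 'k)^('m \<times> 'k)" where
  "ampliate \<Phi> X = (\<chi> p q. \<Phi> (\<chi> a b. X $ (a, snd p) $ (b, snd q)) $ fst p $ fst q)"

definition psi_plus :: "complex^('n \<times> 'n::finite)" where
  "psi_plus = (\<Sum>i\<in>UNIV. kron_vec (ket i) (ket i))"

definition choi :: "((complex^'n^'n::finite) \<Rightarrow>\<^sub>L (complex^'m^'m::finite)) \<Rightarrow> complex^('m \<times> 'n)^('m \<times> 'n)" where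
  "choi \<Phi> = ampliate (blinfun_apply \<Phi>) (proj psi_plus)"

definition ppovm ::
  "complex^('m::finite \<times> 'n::finite)^('m \<times> 'n) \<Rightarrow> complex^('m \<times> 'n)^('m \<times> 'n) \<Rightarrow> bool" where
  "ppovm F F_perp \<longleftrightarrow> psd F \<and> psd F_perp \<and>
     (\<exists>\<sigma>. density \<sigma> \<and> F + F_perp = kron (mat 1) \<sigma>)"

text \<open>The probability of outcome \<open>1\<close>. The trace is real on channels if \<open>F\<close> is positive.\<close>

definition outcome_prob ::
  "complex^('m::finite \<times> 'n::finite)^('m \<times> 'n) \<Rightarrow> ((complex^'n^'n) \<Rightarrow>\<^sub>L (complex^'m^'m)) \<Rightarrow> real" where
  "outcome_prob F \<Phi> = Re (trace (choi \<Phi> ** F))"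

text \<open>The first tensor factor is the output space, the second the input space.\<close>

definition normal_form ::
  "complex^2^2 \<Rightarrow> complex^2^2 \<Rightarrow> (2 \<Rightarrow> complex^2) \<Rightarrow>
     complex^(2 \<times> 2)^(2 \<times> 2) \<Rightarrow> complex^(2 \<times> 2)^(2 \<times> 2) \<Rightarrow>
     complex^(2 \<times> 2)^(2 \<times> 2) \<Rightarrow> complex^(2 \<times> 2)^(2 \<times> 2) \<Rightarrow> bool" where
  "normal_form U_out U_in \<eta> F F_perp F' F'_perp \<longleftrightarrow>
     unitary U_out \<and> unitary U_in \<and> orthonormal_basis \<eta> \<and>
     conjugate_by (kron U_out U_in) F = proj (kron_vec (ket 0) (ket 0)) \<and>
     conjugate_by (kron U_out U_in) F_perp = proj (kron_vec (ket 1) (ket 0)) \<and>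
     conjugate_by (kron U_out U_in) F' = kron (proj (\<eta> 0)) (proj (ket 1)) \<and>
     conjugate_by (kron U_out U_in) F'_perp = kron (proj (\<eta> 1)) (proj (ket 1))"

end

theory Submission
  imports Defs
begin

text \<open>
  For effects on a compact convex set, maximal incompatibility is tested at smoothing parameter
  \<open>1 / 2\<close> with noise \<open>1 / 2\<close>: an effect \<open>p\<close> with positive slack in all compatibility inequalities
  would show that the degree exceeds \<open>1 / 2\<close>, and by separation such a \<open>p\<close> exists unless \<open>0\<close> lies in
  the convex hull of four compact convex sets, which yields a witness square.

  In terms of Choi matrices, a witness square satisfies \<open>C 0 j F = 0\<close> and \<open>C 1 j F\<^sup>\<bottom> = 0\<close>.
  Hence \<open>D = C 1 1 - C 1 0 = C 0 1 - C 0 0\<close> annihilates \<open>F + F\<^sup>\<bottom> = 1 \<otimes> \<sigma>\<close>, while \<open>Tr (D F') = 1\<close>, so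
  \<open>\<sigma>\<close> is singular, that is, a pure state \<open>s\<close>; then \<open>F = A \<otimes> |s\<rangle>\<langle>s|\<close> where \<open>A\<close> and \<open>1 - A\<close> are
  singular, so \<open>A\<close> is a rank-one projection. The same holds for \<open>F'\<close> with a pure state \<open>s'\<close>, and
  \<open>Tr (D F') = 1\<close> forces \<open>s\<close> and \<open>s'\<close> to be orthogonal.
\<close>

section \<open>Complex vectors and positive matrices\<close>

text \<open>The noise \<open>1 / 2\<close> matters: with noise \<open>0\<close>, a single zero of
  \<open>f\<close> would already exclude slack at smoothing \<open>1 / 2\<close>, since
  \<open>p\<close> would have to lie strictly between \<open>0\<close> and \<open>f / 2\<close>, and
  the resulting certificate would say nothing about a square. The separation argument runs in a
  Euclidean space, so channels are replaced by their Choi matrices. The ambient type of channels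
  consists of real-linear maps, which are not determined by their values on matrix units;
  \<open>choi\<close> is therefore injective only on \<open>channels\<close>, and the transport
  lemmas work with \<open>inj_on\<close>. Positive matrices enter through finite sums of rank-one
  terms, produced by elimination. This turns a vanishing trace of a product into a vanishing
  product, and it supplies Kraus operators. Dimension two is used to pass from a singular density to
  a pure state, and from singular \<open>A\<close> and \<open>1 - A\<close> to a complementary pair
  of rank-one projections.\<close>

lemma two_eq_0: "(2::2) = 0"
  by simp

lemma all_2: "(\<forall>i::2. P i) \<longleftrightarrow> P 0 \<and> P 1"
  using forall_2[of P] by (auto simp: two_eq_0)

lemma sum_UNIV_2: "(\<Sum>i\<in>(UNIV::2 set). f i) = f 0 + f 1"
  by (simp add: sum_2 two_eq_0 add.commute)

lemma neq_iff_2: "i \<noteq> j \<longleftrightarrow> i = j + 1" for i j :: 2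
  using exhaust_2[of i] exhaust_2[of j] by (auto simp: two_eq_0)

lemma cinner_add_left: "cinner (x + y) z = cinner x z + cinner y z"
  and cinner_add_right: "cinner z (x + y) = cinner z x + cinner z y"
  and cinner_scale_left: "cinner (c *s x) y = cnj c * cinner x y"
  and cinner_scale_right: "cinner x (c *s y) = c * cinner x y"
  and cinner_zero [simp]: "cinner 0 x = 0" "cinner x 0 = 0"
  and cinner_commute: "cinner y x = cnj (cinner x y)"
  by (simp_all add: cinner_def sum.distrib sum_distrib_left algebra_simps)

lemma cinner_diff_left: "cinner (x - y) z = cinner x z - cinner y z"
  and cinner_diff_right: "cinner z (x - y) = cinner z x - cinner z y"
  by (simp_all add: cinner_def sum_subtractf algebra_simps)

lemma cinner_sum_left: "cinner (\<Sum>i\<in>S. f i) y = (\<Sum>i\<in>S. cinner (f i) y)"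
  and cinner_sum_right: "cinner y (\<Sum>i\<in>S. f i) = (\<Sum>i\<in>S. cinner y (f i))"
  by (induction S rule: infinite_finite_induct) (simp_all add: cinner_add_left cinner_add_right)

lemma cinner_ket_left [simp]: "cinner (ket i) v = v $ i"
  by (simp add: cinner_def ket_def axis_def if_distrib[of cnj] if_distrib[of "\<lambda>x. x * _"] cong: if_cong)

lemma matrix_vector_ket: "(A *v ket i) $ j = A $ j $ i"
  by (simp add: matrix_vector_mult_def ket_def axis_def if_distrib[of "\<lambda>x. _ * x"] cong: if_cong)

lemma cinner_self_nonneg: "0 \<le> cinner v v"
  by (simp add: cinner_def sum_nonneg less_eq_complex_def mult.commute[of "cnj _"] complex_mult_cnj)

lemma cinner_self_real: "cinner v v = of_real (\<Sum>i\<in>UNIV. (cmod (v $ i))\<^sup>2)"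
  by (simp add: cinner_def complex_norm_square[symmetric] mult.commute[of "cnj _"])

lemma cinner_self_eq_0 [simp]: "cinner v v = 0 \<longleftrightarrow> v = 0"
proof
  assume "cinner v v = 0"
  then have "(\<Sum>i\<in>UNIV. (cmod (v $ i))\<^sup>2) = 0"
    unfolding cinner_self_real by (simp only: of_real_eq_0_iff)
  then show "v = 0"
    by (simp add: sum_nonneg_eq_0_iff vec_eq_iff)
qed simp

lemma cinner_mult_right: "cinner v (A *v w) = cinner (cadjoint A *v v) w"
  unfolding cinner_def matrix_vector_mult_def cadjoint_def
  by (simp add: sum_distrib_left sum_distrib_right)
    (subst sum.swap, simp add: mult_ac)

lemma cadjoint_diff: "cadjoint (A - B) = cadjoint A - cadjoint B"
  and cadjoint_cadjoint [simp]: "cadjoint (cadjoint A) = A"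
  by (simp_all add: cadjoint_def vec_eq_iff)

lemma cadjoint_mult: "cadjoint (A ** B) = cadjoint B ** cadjoint (A :: complex^'n::finite^'m)"
  by (simp add: cadjoint_def vec_eq_iff matrix_matrix_mult_def mult.commute)

lemma cadjoint_mat_1 [simp]: "cadjoint (mat 1) = mat 1"
  by (simp add: cadjoint_def vec_eq_iff mat_def)

lemma matrix_scale_vec: "A *v (c *s v) = c *s (A *v v)" for A :: "complex^'n::finite^'m"
  by (simp add: vec_eq_iff matrix_vector_mult_def sum_distrib_left mult_ac)

lemma cadjoint_ketbra: "cadjoint (ketbra v w) = ketbra w v"
  by (simp add: cadjoint_def ketbra_def vec_eq_iff)

lemma ketbra_mult_vec: "ketbra v w *v x = cinner w x *s v"
  by (simp add: ketbra_def cinner_def vec_eq_iff matrix_vector_mult_def sum_distrib_left mult_ac)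

lemma mult_ketbra: "A ** ketbra v w = ketbra (A *v v) w" for A :: "complex^'n::finite^'m"
  by (simp add: ketbra_def vec_eq_iff matrix_matrix_mult_def matrix_vector_mult_def sum_distrib_left sum_distrib_right mult_ac)

lemma ketbra_mult: "ketbra v w ** A = ketbra v (cadjoint A *v w)" for A :: "complex^'k^'n::finite"
  by (simp add: ketbra_def vec_eq_iff matrix_matrix_mult_def matrix_vector_mult_def cadjoint_def sum_distrib_left sum_distrib_right mult_ac)

lemma trace_ketbra: "trace (ketbra v w) = cinner w v"
  by (simp add: trace_def ketbra_def cinner_def mult.commute)

lemma trace_mult_proj: "trace (A ** proj v) = cinner v (A *v v)"
  by (simp add: mult_ketbra trace_ketbra)

lemma matrix_eq_by_cinner:
  fixes A B :: "complex^'n::finite^'n"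
  assumes "\<And>v w. cinner v (A *v w) = cinner v (B *v w)"
  shows "A = B"
proof -
  have "A $ i $ j = B $ i $ j" for i j
    using assms[of "ket i" "ket j"] by (simp add: matrix_vector_ket)
  then show ?thesis by (simp add: vec_eq_iff)
qed

lemma quadratic_form_add:
  fixes A :: "complex^'n::finite^'n"
  shows "cinner (x + c *s y) (A *v (x + c *s y)) =
    cinner x (A *v x) + c * cinner x (A *v y) + cnj c * cinner y (A *v x) + c * cnj c * cinner y (A *v y)"
  by (simp add: matrix_vector_right_distrib matrix_scale_vec cinner_add_left cinner_add_right
      cinner_scale_left cinner_scale_right algebra_simps)

lemma psdD: "psd A \<Longrightarrow> 0 \<le> cinner v (A *v v)"
  by (simp add: psd_def)

text \<open>Polarization: \<open>psd\<close> only speaks of the quadratic form, but its reality at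
  \<open>x + y\<close> and at \<open>x + \<i> y\<close> fixes the imaginary and the real part of the
  off-diagonal values.\<close>

lemma psd_cinner_swap:
  assumes "psd A"
  shows "cinner y (A *v x) = cnj (cinner x (A *v y))"
proof -
  have im: "Im (cinner v (A *v v)) = 0" for v
    using psdD[OF assms, of v] by (simp add: less_eq_complex_def)
  have "Im (cinner x (A *v y)) + Im (cinner y (A *v x)) = 0"
    using im[of "x + 1 *s y"] unfolding quadratic_form_add by (simp add: im)
  moreover have "Re (cinner x (A *v y)) = Re (cinner y (A *v x))"
    using im[of "x + \<i> *s y"] unfolding quadratic_form_add by (simp add: im)
  ultimately show ?thesis by (simp add: complex_eq_iff)
qed

lemma psd_hermitian:
  assumes "psd A"
  shows "cadjoint A = A"
proof (rule matrix_eq_by_cinner)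
  fix v w
  show "cinner v (cadjoint A *v w) = cinner v (A *v w)"
    using psd_cinner_swap[OF assms, of v w] cinner_mult_right[of w A v]
    by (metis cadjoint_cadjoint cinner_commute cinner_mult_right)
qed

text \<open>If \<open>A v\<close> were nonzero, moving from \<open>v\<close> a little way along
  \<open>- A v\<close> would make the quadratic form negative: the linear term has a definite sign
  and beats the quadratic one.\<close>

lemma psd_kernel:
  assumes "psd A" "cinner v (A *v v) = 0"
  shows "A *v v = 0"
proof (rule ccontr)
  assume nz: "A *v v \<noteq> 0"
  define y where "y = A *v v"
  define N where "N = Re (cinner y y)"
  define M where "M = Re (cinner y (A *v y))"
  have N: "cinner y y = of_real N"
    using cinner_self_nonneg[of y] by (simp add: N_def less_eq_complex_def complex_eq_iff)
  have "N > 0"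
    using nz cinner_self_nonneg[of y] N by (auto simp: y_def[symmetric] less_eq_complex_def order_less_le)
  have "M \<ge> 0"
    using psdD[OF assms(1), of y] by (simp add: M_def less_eq_complex_def)
  have vy: "cinner v (A *v y) = of_real N"
    using psd_cinner_swap[OF assms(1), of v y] N by (simp add: y_def)
  have yv: "cinner y (A *v v) = of_real N" using N by (simp add: y_def)
  \<comment> \<open>Small enough that \<open>t * M \<le> N\<close>, while positivity at the shifted
    vector demands \<open>2 * N \<le> t * M\<close>. The \<open>+ 1\<close> guards against
    \<open>M = 0\<close>.\<close>
  define t where "t = N / (M + 1)"
  have "0 \<le> Re (cinner (v + of_real (- t) *s y) (A *v (v + of_real (- t) *s y)))"
    using psdD[OF assms(1)] by (simp only: less_eq_complex_def zero_complex.simps)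
  then have "0 \<le> - (2 * t * N) + t * t * M"
    unfolding quadratic_form_add vy yv assms(2) by (simp add: M_def[symmetric] mult_ac)
  moreover have "t > 0" using \<open>N > 0\<close> \<open>M \<ge> 0\<close> by (simp add: t_def)
  ultimately have "t * (2 * N) \<le> t * (t * M)" and "t > 0" by (simp_all add: algebra_simps)
  then have "2 * N \<le> t * M" by simp
  moreover have "t * M \<le> N"
    using \<open>N > 0\<close> \<open>M \<ge> 0\<close> by (simp add: t_def field_simps)
  ultimately show False using \<open>N > 0\<close> by linarith
qed

lemma psd_proj: "psd (proj v)"
  unfolding psd_def
proof
  fix x
  have "cinner x (proj v *v x) = cinner v x * cnj (cinner v x)"
    using cinner_commute[of x v] by (simp add: ketbra_mult_vec cinner_scale_right)
  then show "0 \<le> cinner x (proj v *v x)"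
    by (simp add: complex_mult_cnj less_eq_complex_def)
qed

lemma psd_zero [simp]: "psd 0"
  by (simp add: psd_def)

lemma psd_add: "psd A \<Longrightarrow> psd B \<Longrightarrow> psd (A + B)"
  by (simp add: psd_def matrix_vector_mult_add_rdistrib cinner_add_right)

lemma psd_sum: "(\<And>i. i \<in> S \<Longrightarrow> psd (f i)) \<Longrightarrow> psd (\<Sum>i\<in>S. f i)"
  by (induction S rule: infinite_finite_induct) (simp_all add: psd_add)

lemma psd_mat_1: "psd (mat 1)"
  by (simp add: psd_def cinner_self_nonneg)

lemma psd_conjugate: "psd A \<Longrightarrow> psd (conjugate_by U A)"
proof -
  have "cinner v (conjugate_by U A *v v) = cinner (cadjoint U *v v) (A *v (cadjoint U *v v))" for v
    unfolding conjugate_by_def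
    by (simp add: matrix_vector_mul_assoc[symmetric] cinner_mult_right[of v])
  then show "psd A \<Longrightarrow> psd (conjugate_by U A)" by (simp add: psd_def)
qed

text \<open>One step of the Cholesky decomposition.\<close>

lemma psd_schur_complement:
  assumes "psd A" and nz: "A $ p $ p \<noteq> 0"
  shows "\<exists>w. psd (A - proj w) \<and> (\<forall>q. (A - proj w) $ p $ q = 0) \<and> (\<forall>q. A $ q $ p = 0 \<longrightarrow> w $ q = 0)"
proof -
  define b where "b = Re (A $ p $ p)"
  have Ab: "cinner (ket p) (A *v ket p) = A $ p $ p" by (simp add: matrix_vector_ket)
  then have "0 \<le> A $ p $ p" using psdD[OF assms(1), of "ket p"] by simp
  then have b: "A $ p $ p = of_real b" "b > 0"
    using nz by (auto simp: b_def less_eq_complex_def complex_eq_iff order_less_le)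
  define y where "y = A *v ket p"
  define w where "w = complex_of_real (1 / sqrt b) *s y"
  have w: "w $ q * cnj (w $ r) = A $ q $ p * cnj (A $ r $ p) / of_real b" for q r
  proof -
    have "complex_of_real (sqrt b) * complex_of_real (sqrt b) = of_real b"
      using b by (simp flip: of_real_mult)
    then show ?thesis by (simp add: w_def y_def matrix_vector_ket field_simps)
  qed
  have herm: "cnj (A $ q $ r) = A $ r $ q" for q r
    using psd_hermitian[OF assms(1)] by (simp add: cadjoint_def vec_eq_iff)
  have "psd (A - proj w)"
    unfolding psd_def
  proof
    fix v
    define z where "z = cinner y v"
    \<comment> \<open>Completing the square: this \<open>c\<close> minimises the form of
      \<open>A\<close> on the line through \<open>v\<close> in direction \<open>ket p\<close>, and
      the minimum is exactly the form of \<open>A - proj w\<close> at \<open>v\<close>.\<close>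
    define c where "c = - z / of_real b"
    have vp: "cinner v (A *v ket p) = cnj z" and pv: "cinner (ket p) (A *v v) = z"
      using psd_cinner_swap[OF assms(1), of v "ket p"] cinner_commute[of v y]
      by (simp_all add: z_def y_def)
    have "cinner w v = complex_of_real (1 / sqrt b) * z"
      by (simp add: w_def z_def cinner_scale_left)
    moreover have "complex_of_real (sqrt b) * complex_of_real (sqrt b) = of_real b"
      using b by (simp flip: of_real_mult)
    ultimately have "cinner v (proj w *v v) = z * cnj z / of_real b"
      using cinner_commute[of v w] by (simp add: ketbra_mult_vec cinner_scale_right field_simps)
    then have "cinner v ((A - proj w) *v v) = cinner v (A *v v) - z * cnj z / of_real b"
      by (simp add: matrix_vector_mult_diff_rdistrib cinner_diff_right)
    also have "\<dots> = cinner (v + c *s ket p) (A *v (v + c *s ket p))"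
      unfolding quadratic_form_add vp pv Ab b(1) using b(2) by (simp add: c_def field_simps)
    also have "0 \<le> \<dots>" using psdD[OF assms(1)] .
    finally show "0 \<le> cinner v ((A - proj w) *v v)" .
  qed
  moreover have "(A - proj w) $ p $ q = 0" for q
    using w[of p q] herm[of q p] b by (simp add: ketbra_def)
  moreover have "A $ q $ p = 0 \<Longrightarrow> w $ q = 0" for q
    by (simp add: w_def y_def matrix_vector_ket)
  ultimately show ?thesis by blast
qed

text \<open>Induction on a set \<open>S\<close> containing all nonzero rows. Each step clears one
  row; the last conjunct of the elimination step makes \<open>w\<close> vanish on rows that are
  already zero, so they stay zero.\<close>

lemma psd_supported_sum_proj:
  assumes "finite S" "psd A" "\<And>p q. p \<notin> S \<Longrightarrow> A $ p $ q = 0"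
  shows "\<exists>w. A = (\<Sum>i\<in>S. proj (w i))"
  using assms
proof (induction S arbitrary: A rule: finite_induct)
  case empty
  then show ?case by (simp add: vec_eq_iff)
next
  case (insert p S)
  have herm: "cnj (A $ q $ r) = A $ r $ q" for q r
    using psd_hermitian[OF insert.prems(1)] by (simp add: cadjoint_def vec_eq_iff)
  have "\<exists>w. psd (A - proj w) \<and> (\<forall>q. (A - proj w) $ p $ q = 0) \<and> (\<forall>q. A $ q $ p = 0 \<longrightarrow> w $ q = 0)"
  \<comment> \<open>A zero pivot needs no elimination: positivity forces the whole row and column to
    vanish, and \<open>w = 0\<close> works.\<close>
  proof (cases "A $ p $ p = 0")
    case True
    then have "A *v ket p = 0"
      using psd_kernel[OF insert.prems(1), of "ket p"] by (simp add: matrix_vector_ket)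
    then have "A $ q $ p = 0" for q by (metis matrix_vector_ket zero_index)
    then have "A $ p $ q = 0" for q using herm[of q p] by simp
    then show ?thesis using insert.prems(1)
      by (intro exI[of _ 0]) (simp add: ketbra_def vec_eq_iff zero_vec_def[symmetric])
  qed (rule psd_schur_complement[OF insert.prems(1)])
  then obtain w where w: "psd (A - proj w)" "\<And>q. (A - proj w) $ p $ q = 0"
      "\<And>q. A $ q $ p = 0 \<Longrightarrow> w $ q = 0" by blast
  have "(A - proj w) $ q $ r = 0" if "q \<notin> S" for q r
  proof (cases "q = p")
    case False
    then show ?thesis using insert.prems(2)[of q] w(3)[of q] that by (simp add: ketbra_def)
  qed (use w(2) in simp)
  from insert.IH[OF w(1) this] obtain w' where "A - proj w = (\<Sum>i\<in>S. proj (w' i))" by blast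
  then have "A = proj w + (\<Sum>i\<in>S. proj (w' i))" by (simp add: algebra_simps)
  also have "(\<Sum>i\<in>S. proj (w' i)) = (\<Sum>i\<in>S. proj ((w'(p := w)) i))"
    using insert.hyps by (intro sum.cong) auto
  finally have "A = (\<Sum>i\<in>insert p S. proj ((w'(p := w)) i))" using insert.hyps by simp
  then show ?case by blast
qed

corollary psd_sum_proj:
  assumes "psd (A :: complex^'n^'n::finite)"
  obtains w :: "'n \<Rightarrow> complex^'n" where "A = (\<Sum>i\<in>UNIV. proj (w i))"
  using psd_supported_sum_proj[OF finite[of UNIV] assms] by auto

lemma matrix_mult_add_left: "(A + B) ** C = A ** C + B ** C"
  and matrix_mult_diff_left: "(A - B) ** C = A ** C - B ** C"
  for A B :: "complex^'n::finite^'m" and C :: "complex^'k^'n"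
  by (simp_all add: vec_eq_iff matrix_matrix_mult_def sum.distrib sum_subtractf algebra_simps)

lemma matrix_mult_sum: "B ** (\<Sum>i\<in>S. f i) = (\<Sum>i\<in>S. B ** f i)"
  for B :: "complex^'n::finite^'m" and f :: "_ \<Rightarrow> complex^'n^'n"
  by (induction S rule: infinite_finite_induct)
    (simp_all add: matrix_add_ldistrib)

lemma trace_sum: "trace (\<Sum>i\<in>S. f i) = (\<Sum>i\<in>S. trace (f i))" for f :: "_ \<Rightarrow> complex^'n^'n"
  by (induction S rule: infinite_finite_induct) (simp_all add: trace_add, simp_all add: trace_def)

lemma trace_mult_psd_nonneg:
  fixes A B :: "complex^'a^'a::finite"
  assumes "psd A" "psd B"
  shows "0 \<le> trace (A ** B)"
proof -
  obtain w :: "'a \<Rightarrow> complex^'a" where "B = (\<Sum>i\<in>UNIV. proj (w i))" using psd_sum_proj[OF assms(2)] .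
  then show ?thesis
    by (simp add: matrix_mult_sum trace_sum trace_mult_proj sum_nonneg psdD assms(1))
qed

text \<open>Over a rank-one decomposition of \<open>B\<close> the trace is a sum of nonnegative
  terms, so each vanishes and \<open>A\<close> kills every vector of the decomposition. This is how
  an outcome of probability zero becomes an operator equation.\<close>

lemma trace_mult_psd_eq_0:
  fixes A B :: "complex^'a^'a::finite"
  assumes "psd A" "psd B" "Re (trace (A ** B)) = 0"
  shows "A ** B = 0"
proof -
  obtain w :: "'a \<Rightarrow> complex^'a" where w: "B = (\<Sum>i\<in>UNIV. proj (w i))" using psd_sum_proj[OF assms(2)] .
  have pos: "0 \<le> cinner (w i) (A *v w i)" for i using psdD[OF assms(1)] .
  have "(\<Sum>i\<in>UNIV. Re (cinner (w i) (A *v w i))) = 0"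
    using assms(3) by (simp add: w matrix_mult_sum trace_sum trace_mult_proj)
  then have "Re (cinner (w i) (A *v w i)) = 0" for i
    using pos by (subst (asm) sum_nonneg_eq_0_iff) (simp_all add: less_eq_complex_def)
  then have "cinner (w i) (A *v w i) = 0" for i
    using pos[of i] by (simp add: less_eq_complex_def complex_eq_iff)
  then have "A *v w i = 0" for i using psd_kernel[OF assms(1)] by blast
  then have "A ** proj (w i) = 0" for i by (simp add: mult_ketbra, simp add: ketbra_def vec_eq_iff)
  then show ?thesis by (simp add: w matrix_mult_sum)
qed

section \<open>Maximal incompatibility and witness squares\<close>

lemma effectsI:
  assumes "\<And>x. x \<in> K \<Longrightarrow> 0 \<le> f x" "\<And>x. x \<in> K \<Longrightarrow> f x \<le> 1"
    and "\<And>x y t. x \<in> K \<Longrightarrow> y \<in> K \<Longrightarrow> 0 \<le> t \<Longrightarrow> t \<le> 1 \<Longrightarrow>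
      f ((1 - t) *\<^sub>R x + t *\<^sub>R y) = (1 - t) * f x + t * f y"
  shows "f \<in> effects K"
  using assms by (auto simp: effects_def)

lemma effects_bounds: "f \<in> effects K \<Longrightarrow> x \<in> K \<Longrightarrow> 0 \<le> f x \<and> f x \<le> 1"
  by (simp add: effects_def)

lemma effects_affine:
  "f \<in> effects K \<Longrightarrow> x \<in> K \<Longrightarrow> y \<in> K \<Longrightarrow> 0 \<le> t \<Longrightarrow> t \<le> 1 \<Longrightarrow>
    f ((1 - t) *\<^sub>R x + t *\<^sub>R y) = (1 - t) * f x + t * f y"
  by (simp add: effects_def)

lemma effects_weighted:
  assumes "f \<in> effects K" "x \<in> K" "y \<in> K" "0 \<le> a" "0 \<le> b" "a + b = 1 / 2"
  shows "f ((2 * a) *\<^sub>R x + (2 * b) *\<^sub>R y) = 2 * (a * f x + b * f y)"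
proof -
  have "1 - 2 * b = 2 * a" using assms by simp
  with effects_affine[OF assms(1-3), of "2 * b"] assms(4-6) show ?thesis by simp
qed

text \<open>With noise \<open>0\<close> the effect \<open>p = 0\<close> suffices, because
  \<open>f / 2 + f' / 2 \<le> 1\<close>. This puts \<open>1 / 2\<close> into the set whose supremum
  is the degree.\<close>

lemma compatible_half_smoothing:
  assumes "f \<in> effects K" "f' \<in> effects K"
  shows "compatible K (\<lambda>x. 1 / 2 * f x + (1 - 1 / 2) * 0) (\<lambda>x. 1 / 2 * f' x + (1 - 1 / 2) * 0)"
  unfolding compatible_def
proof (intro bexI ballI)
  fix x assume "x \<in> K"
  then show "0 \<le> 1 / 2 * f x + (1 - 1 / 2) * 0 \<and> 0 \<le> 1 / 2 * f' x + (1 - 1 / 2) * 0 \<and>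
      1 / 2 * f x + (1 - 1 / 2) * 0 + (1 / 2 * f' x + (1 - 1 / 2) * 0) \<le> 1 + (0::real)"
    using effects_bounds[OF assms(1)] effects_bounds[OF assms(2)] by force
qed (simp add: effectsI)

definition compatibility_range :: "'a::real_vector set \<Rightarrow> ('a \<Rightarrow> real) \<Rightarrow> ('a \<Rightarrow> real) \<Rightarrow> real set" where
  "compatibility_range K f f' = {t \<in> {0..1}. \<exists>\<mu>\<in>{0..1}. \<exists>\<mu>'\<in>{0..1}.
     compatible K (\<lambda>x. t * f x + (1 - t) * \<mu>) (\<lambda>x. t * f' x + (1 - t) * \<mu>')}"

lemma compatibility_degree_eq: "compatibility_degree K f f' = Sup (compatibility_range K f f')"
  by (simp add: compatibility_degree_def compatibility_range_def)

lemma half_in_compatibility_range: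
  assumes "f \<in> effects K" "f' \<in> effects K"
  shows "1 / 2 \<in> compatibility_range K f f'"
  using compatible_half_smoothing[OF assms] unfolding compatibility_range_def
  by (auto intro!: bexI[of _ 0])

lemma bdd_above_compatibility_range: "bdd_above (compatibility_range K f f')"
  by (rule bdd_aboveI[of _ 1]) (simp add: compatibility_range_def)

text \<open>An affine \<open>p\<close> has the same sum over both diagonals. Bounding it below at
  \<open>x 0 0\<close> and \<open>x 1 1\<close> and above at \<open>x 1 0\<close> and
  \<open>x 0 1\<close>, the noise terms cancel and \<open>2 * t \<le> 1\<close> is left.\<close>

lemma witness_square_imp_maximally_incompatible:
  assumes f: "f \<in> effects K" "f' \<in> effects K" and w: "witness_square K f f' x"
  shows "maximally_incompatible K f f'"
proof -
  have "t \<le> 1 / 2" if t: "t \<in> compatibility_range K f f'" for t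
  proof -
    obtain \<mu> \<mu>' p where p: "p \<in> effects K"
      and le: "\<And>x. x \<in> K \<Longrightarrow> p x \<le> t * f x + (1 - t) * \<mu>" "\<And>x. x \<in> K \<Longrightarrow> p x \<le> t * f' x + (1 - t) * \<mu>'"
        "\<And>x. x \<in> K \<Longrightarrow> t * f x + (1 - t) * \<mu> + (t * f' x + (1 - t) * \<mu>') \<le> 1 + p x"
      using t unfolding compatibility_range_def compatible_def by blast
    have K: "x i j \<in> K" and v: "f (x i j) = of_bool (i = 1)" "f' (x i j) = of_bool (j = 1)" for i j
      using w by (auto simp: witness_square_def)
    have sq: "(1 - 1 / 2) *\<^sub>R x 0 0 + (1 / 2) *\<^sub>R x 1 1 = (1 - 1 / 2) *\<^sub>R x 1 0 + (1 / 2) *\<^sub>R x 0 1"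
      using w by (simp add: witness_square_def scaleR_add_right)
    have "p (x 0 0) + p (x 1 1) = p (x 1 0) + p (x 0 1)"
      using effects_affine[OF p K[of 0 0] K[of 1 1], of "1 / 2"]
        effects_affine[OF p K[of 1 0] K[of 0 1], of "1 / 2"] sq by simp
    moreover have "0 \<le> p (x 0 0)" using effects_bounds[OF p K] by blast
    moreover have "p (x 1 0) \<le> (1 - t) * \<mu>'" "p (x 0 1) \<le> (1 - t) * \<mu>"
      "t + (1 - t) * \<mu> + (t + (1 - t) * \<mu>') \<le> 1 + p (x 1 1)"
      using le(2)[OF K, of 1 0] le(1)[OF K, of 0 1] le(3)[OF K, of 1 1] by (simp_all add: v)
    ultimately show ?thesis by linarith
  qed
  then have "Sup (compatibility_range K f f') = 1 / 2"
    using half_in_compatibility_range[OF f] by (intro cSup_eq_maximum) auto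
  then show ?thesis by (simp add: maximally_incompatible_def compatibility_degree_eq)
qed

text \<open>A linear functional \<open>(q, q0, r)\<close> takes the value
  \<open>s * (q \<bullet> x + q0) + r * h x\<close> on such a triple. It thus compares an affine
  function with the bound \<open>h\<close>, from the side given by the sign \<open>s\<close>; the
  middle component carries the constant term.\<close>

lemma convex_graph_image:
  assumes "convex K" "\<And>x y t. x \<in> K \<Longrightarrow> y \<in> K \<Longrightarrow> 0 \<le> t \<Longrightarrow> t \<le> 1 \<Longrightarrow>
      h ((1 - t) *\<^sub>R x + t *\<^sub>R y) = (1 - t) * h x + t * (h y :: real)"
  shows "convex ((\<lambda>x. (s *\<^sub>R x, s :: real, h x)) ` K)"
  unfolding convex_alt
proof (safe)
  fix x y and t :: real assume xy: "x \<in> K" "y \<in> K" "0 \<le> t" "t \<le> 1"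
  then have "(1 - t) *\<^sub>R x + t *\<^sub>R y \<in> K" using assms(1) by (simp add: convex_alt)
  moreover have "(1 - t) *\<^sub>R (s *\<^sub>R x, s, h x) + t *\<^sub>R (s *\<^sub>R y, s, h y) =
      (s *\<^sub>R ((1 - t) *\<^sub>R x + t *\<^sub>R y), s, h ((1 - t) *\<^sub>R x + t *\<^sub>R y))"
    using assms(2)[OF xy] by (simp add: algebra_simps)
  ultimately show "(1 - t) *\<^sub>R (s *\<^sub>R x, s, h x) + t *\<^sub>R (s *\<^sub>R y, s, h y) \<in>
      (\<lambda>x. (s *\<^sub>R x, s, h x)) ` K"
    by (metis (no_types, lifting) image_eqI)
qed

text \<open>The weights of a vanishing dual certificate at smoothing parameter \<open>1 / 2\<close>, noise \<open>1 / 2\<close>,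
  are forced to be equal, so that the certificate is a witness square.\<close>

lemma witness_square_of_certificate:
  fixes K :: "'a::real_vector set"
  assumes f: "f \<in> effects K" "f' \<in> effects K"
    and K: "x00 \<in> K" "x11 \<in> K" "x10 \<in> K" "x01 \<in> K"
    and a: "0 \<le> a00" "0 \<le> a11" "0 \<le> a10" "0 \<le> a01"
    and w: "a00 + a11 = 1 / 2" "a10 + a01 = 1 / 2"
    and vec: "a00 *\<^sub>R x00 + a11 *\<^sub>R x11 = a10 *\<^sub>R x10 + a01 *\<^sub>R x01"
    and val: "a11 * ((f x11 + f' x11 - 1) / 2) = a10 * (f' x10 / 2 + 1 / 4) + a01 * (f x01 / 2 + 1 / 4)"
  shows "\<exists>x. witness_square K f f' x"
proof -
  have vec2: "(2 * a00) *\<^sub>R x00 + (2 * a11) *\<^sub>R x11 = (2 * a10) *\<^sub>R x10 + (2 * a01) *\<^sub>R x01"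
    using arg_cong[OF vec, of "\<lambda>z. 2 *\<^sub>R z"] by (simp add: scaleR_add_right)
  have lin: "a00 * h x00 + a11 * h x11 = a10 * h x10 + a01 * h x01" if h: "h \<in> effects K" for h
    using effects_weighted[OF h K(1,2) a(1,2) w(1)] effects_weighted[OF h K(3,4) a(3,4) w(2)] vec2 by simp
  have b: "0 \<le> c * h x \<and> c * h x \<le> c" if "h \<in> effects K" "x \<in> K" "0 \<le> c" for h x c
    using effects_bounds[OF that(1,2)] that(3) by (simp add: mult_left_le)
  note b00 = b[OF f(1) K(1) a(1)] b[OF f(2) K(1) a(1)]
  note b11 = b[OF f(1) K(2) a(2)] b[OF f(2) K(2) a(2)]
  note b10 = b[OF f(1) K(3) a(3)] b[OF f(2) K(3) a(3)]
  note b01 = b[OF f(1) K(4) a(4)] b[OF f(2) K(4) a(4)]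
  have val': "a11 * f x11 + a11 * f' x11 - a11 = a10 * f' x10 + a01 * f x01 + 1 / 4"
  proof -
    have "2 * (a11 * ((f x11 + f' x11 - 1) / 2)) = 2 * (a10 * (f' x10 / 2 + 1 / 4) + a01 * (f x01 / 2 + 1 / 4))"
      using val by simp
    then show ?thesis using w(2) by (simp add: algebra_simps)
  qed
  note facts = lin[OF f(1)] lin[OF f(2)] b00 b11 b10 b01 val' w a
  \<comment> \<open>From \<open>val'\<close>, the left side is at most \<open>a11\<close> and the
    right side at least \<open>1 / 4\<close>, so \<open>a11 \<ge> 1 / 4\<close>. Conversely,
    bounding \<open>a11 * f x11\<close> and \<open>a11 * f' x11\<close> by the two instances of
    \<open>lin\<close>, with \<open>f x10\<close> and \<open>f' x01\<close> replaced by
    \<open>1\<close>, gives \<open>a11 \<le> 1 / 4\<close>. Equality must then hold in every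
    estimate, which yields the other weights and the vertex values.\<close>
  have a11: "a11 = 1 / 4" using facts by linarith
  have a00: "a00 = 1 / 4" using a11 w by simp
  have a10: "a10 = 1 / 4" using facts a11 by linarith
  have a01: "a01 = 1 / 4" using a10 w by simp
  note facts' = facts[unfolded a00 a11 a10 a01]
  have v: "f x00 = 0" "f' x00 = 0" "f x11 = 1" "f' x11 = 1" "f x10 = 1" "f' x10 = 0" "f x01 = 0" "f' x01 = 1"
    using facts' by linarith+
  define x :: "2 \<Rightarrow> 2 \<Rightarrow> 'a" where
    "x i j = (if i = 0 then if j = 0 then x00 else x01 else if j = 0 then x10 else x11)" for i j
  have "(1 / 2) *\<^sub>R (x00 + x11) = (1 / 2) *\<^sub>R (x10 + x01)"
    using vec2 by (simp add: a00 a11 a10 a01 scaleR_add_right)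
  then have "witness_square K f f' x"
    using K v by (simp add: witness_square_def all_2 x_def)
  then show ?thesis by blast
qed

text \<open>Raising the smoothing parameter from \<open>1 / 2\<close> to \<open>1 / 2 + e\<close>
  lowers an upper bound on \<open>p\<close> by at most \<open>e / 2\<close> and raises the
  nonconstant lower bound by at most \<open>e\<close>. The uniform slack \<open>d\<close> absorbs
  both.\<close>

lemma affine_separation_imp_compatible:
  assumes f: "f \<in> effects K" "f' \<in> effects K"
    and p: "\<And>x y t. x \<in> K \<Longrightarrow> y \<in> K \<Longrightarrow> 0 \<le> t \<Longrightarrow> t \<le> 1 \<Longrightarrow>
      p ((1 - t) *\<^sub>R x + t *\<^sub>R y) = (1 - t) * p x + t * (p y :: real)"
    and d: "0 < d"
    and sep: "\<And>x. x \<in> K \<Longrightarrow> d \<le> p x" "\<And>x. x \<in> K \<Longrightarrow> (f x + f' x - 1) / 2 + d \<le> p x"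
      "\<And>x. x \<in> K \<Longrightarrow> p x + d \<le> f x / 2 + 1 / 4" "\<And>x. x \<in> K \<Longrightarrow> p x + d \<le> f' x / 2 + 1 / 4"
  shows "\<not> maximally_incompatible K f f'"
proof -
  \<comment> \<open>The cap \<open>1 / 2\<close> keeps \<open>t \<le> 1\<close>.\<close>
  define e where "e = min d (1 / 2)"
  define t where "t = 1 / 2 + e"
  have e: "0 < e" "e \<le> d" "e \<le> 1 / 2" using d by (auto simp: e_def)
  have "compatible K (\<lambda>x. t * f x + (1 - t) * (1 / 2)) (\<lambda>x. t * f' x + (1 - t) * (1 / 2))"
    unfolding compatible_def
  proof (intro bexI ballI)
    fix x assume x: "x \<in> K"
    have "0 \<le> e * f x" "e * f x \<le> e" "0 \<le> e * f' x" "e * f' x \<le> e"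
      using effects_bounds[OF f(1) x] effects_bounds[OF f(2) x] e by (simp_all add: mult_left_le)
    moreover have "t * f x = f x / 2 + e * f x" "t * f' x = f' x / 2 + e * f' x"
      "(1 - t) * (1 / 2) = 1 / 4 - e / 2"
      by (simp_all add: t_def field_simps)
    moreover have "(f x + f' x - 1) / 2 = f x / 2 + f' x / 2 - 1 / 2"
      by (simp add: field_simps)
    ultimately show "p x \<le> t * f x + (1 - t) * (1 / 2) \<and> p x \<le> t * f' x + (1 - t) * (1 / 2) \<and>
      t * f x + (1 - t) * (1 / 2) + (t * f' x + (1 - t) * (1 / 2)) \<le> 1 + p x"
      using sep[OF x] e by (intro conjI; linarith)
  next
    show "p \<in> effects K"
    proof (rule effectsI)
      fix x assume x: "x \<in> K"
      show "0 \<le> p x" "p x \<le> 1"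
        using sep[OF x] d effects_bounds[OF f(1) x] by linarith+
    qed (use p in auto)
  qed
  then have "t \<in> compatibility_range K f f'"
    using e unfolding compatibility_range_def
    by (intro CollectI conjI bexI[of _ "1 / 2"]) (auto simp: t_def)
  then have "t \<le> compatibility_degree K f f'"
    unfolding compatibility_degree_eq by (intro cSup_upper bdd_above_compatibility_range)
  then show ?thesis using e by (simp add: maximally_incompatible_def t_def)
qed

theorem maximally_incompatible_iff_witness_square:
  fixes K :: "'a::euclidean_space set"
  assumes K: "compact K" "convex K" "K \<noteq> {}"
    and f: "f \<in> effects K" "f' \<in> effects K" and cont: "continuous_on K f" "continuous_on K f'"
  shows "maximally_incompatible K f f' \<longleftrightarrow> (\<exists>x. witness_square K f f' x)"
proof
  assume mi: "maximally_incompatible K f f'"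
  show "\<exists>x. witness_square K f f' x"
  proof (rule ccontr)
    assume none: "\<nexists>x. witness_square K f f' x"
    \<comment> \<open>The indices \<open>0\<close>, \<open>1\<close> stand for the lower bounds
      \<open>0\<close> and \<open>(f + f' - 1) / 2\<close> on \<open>p\<close>, the indices
      \<open>2\<close>, \<open>3\<close> for the upper bounds \<open>f' / 2 + 1 / 4\<close> and
      \<open>f / 2 + 1 / 4\<close>. Each is written as \<open>h k x \<le> s k * p x\<close>, so
      upper bounds appear negated.\<close>
    define s :: "nat \<Rightarrow> real" where "s k = (if k \<le> 1 then 1 else - 1)" for k
    define h where "h k x = (if k = 0 then 0 else if k = 1 then (f x + f' x - 1) / 2
        else if k = 2 then - (f' x / 2 + 1 / 4) else - (f x / 2 + 1 / 4))" for k :: nat and x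
    define T where "T k = (\<lambda>x. (s k *\<^sub>R x, s k, h k x)) ` K" for k
    define I where "I = {0, 1, 2, 3 :: nat}"
    have aff: "h k ((1 - t) *\<^sub>R x + t *\<^sub>R y) = (1 - t) * h k x + t * h k y"
      if "x \<in> K" "y \<in> K" "0 \<le> t" "t \<le> 1" for k x y t
      using effects_affine[OF f(1) that] effects_affine[OF f(2) that]
      by (simp add: h_def field_simps)
    have conv: "convex (T k)" for k
      unfolding T_def by (rule convex_graph_image[OF K(2) aff])
    have "continuous_on K (h k)" for k
      unfolding h_def using cont
      by (cases "k = 0"; cases "k = 1"; cases "k = 2") (auto intro!: continuous_intros)
    then have comp: "compact (T k)" for k
      unfolding T_def using K(1) by (intro compact_continuous_image continuous_intros)
    have "compact (\<Union>(T ` I))"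
      using comp by (intro compact_UN) (auto simp: I_def)
    then have closed: "closed (convex hull (\<Union>(T ` I)))"
      by (intro compact_imp_closed compact_convex_hull)
    have hull: "convex hull (\<Union>(T ` I)) =
        {sum (\<lambda>i. c i *\<^sub>R z i) I | c z. (\<forall>i\<in>I. c i \<ge> 0) \<and> sum c I = 1 \<and> (\<forall>i\<in>I. z i \<in> T i)}"
      using conv K(3) by (intro convex_hull_finite_union) (auto simp: I_def T_def)
    have "0 \<notin> convex hull (\<Union>(T ` I))"
    proof
      assume "0 \<in> convex hull (\<Union>(T ` I))"
      then obtain c z where c: "\<And>i. i \<in> I \<Longrightarrow> c i \<ge> 0" "sum c I = 1" "\<And>i. i \<in> I \<Longrightarrow> z i \<in> T i"
        and z: "(\<Sum>i\<in>I. c i *\<^sub>R z i) = 0"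
        unfolding hull by force
      have "\<exists>x\<in>K. z i = (s i *\<^sub>R x, s i, h i x)" if "i \<in> I" for i
        using c(3)[OF that] by (auto simp: T_def)
      then obtain x where x: "\<And>i. i \<in> I \<Longrightarrow> x i \<in> K" "\<And>i. i \<in> I \<Longrightarrow> z i = (s i *\<^sub>R x i, s i, h i (x i))"
        by metis
      have "(\<Sum>i\<in>I. c i *\<^sub>R (s i *\<^sub>R x i, s i, h i (x i))) = 0"
        using z x(2) by simp
      \<comment> \<open>The three components of the vanishing combination. The middle one balances
        lower against upper bounds, so each pair of weights sums to \<open>1 / 2\<close>.\<close>
      then have "c 0 *\<^sub>R x 0 + c 1 *\<^sub>R x 1 = c 2 *\<^sub>R x 2 + c 3 *\<^sub>R x 3"
        "c 0 + c 1 = c 2 + c 3"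
        "c 1 * ((f (x 1) + f' (x 1) - 1) / 2) =
          c 2 * (f' (x 2) / 2 + 1 / 4) + c 3 * (f (x 3) / 2 + 1 / 4)"
        by (simp_all add: I_def s_def h_def zero_prod_def algebra_simps)
      moreover have "c 0 + c 1 + (c 2 + c 3) = 1"
        using c(2) by (simp add: I_def)
      ultimately have "\<exists>x. witness_square K f f' x"
        using x(1) c(1)
        by (intro witness_square_of_certificate[OF f, of "x 0" "x 1" "x 2" "x 3" "c 0" "c 1" "c 2" "c 3"])
          (auto simp: I_def)
      then show False using none by blast
    qed
    from separating_hyperplane_closed_0[OF convex_convex_hull closed this]
    obtain w b where b: "0 < b" and w: "\<And>z. z \<in> convex hull (\<Union>(T ` I)) \<Longrightarrow> b < w \<bullet> z"
      by blast
    obtain q q0 r where wq: "w = (q, q0, r)" by (metis prod.collapse)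
    define l where "l x = q \<bullet> x + q0" for x
    have T: "b < s k * l x + r * h k x" if "k \<in> I" "x \<in> K" for k x
    proof -
      have "(s k *\<^sub>R x, s k, h k x) \<in> convex hull (\<Union>(T ` I))"
        using that by (intro hull_inc) (auto simp: T_def)
      from w[OF this] show ?thesis by (simp add: wq l_def algebra_simps)
    qed
    have l: "b < l x" "b < l x + r * ((f x + f' x - 1) / 2)"
      "b < - l x - r * (f' x / 2 + 1 / 4)" "b < - l x - r * (f x / 2 + 1 / 4)" if "x \<in> K" for x
      using T[OF _ that, of 0] T[OF _ that, of 1] T[OF _ that, of 2] T[OF _ that, of 3]
      by (simp_all add: s_def h_def I_def algebra_simps)
    \<comment> \<open>The hyperplane is not vertical: for \<open>r \<ge> 0\<close> the bounds with
      indices \<open>0\<close> and \<open>3\<close> would make \<open>l\<close> both positive and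
      negative. Dividing by \<open>- r\<close> then turns \<open>l\<close> into the required
      \<open>p\<close>.\<close>
    have "r < 0"
    proof (rule ccontr)
      assume "\<not> r < 0"
      obtain x where x: "x \<in> K" using K(3) by blast
      have "0 \<le> r * (f x / 2 + 1 / 4)"
        using \<open>\<not> r < 0\<close> effects_bounds[OF f(1) x] by simp
      then show False using l(1,4)[OF x] b by linarith
    qed
    have "\<not> maximally_incompatible K f f'"
    proof (rule affine_separation_imp_compatible[OF f, where p = "\<lambda>x. l x / (- r)" and d = "b / (- r)"])
      show "0 < b / (- r)" using b \<open>r < 0\<close> by (simp add: field_simps)
    next
      fix x y :: 'a and t :: real
      have "l ((1 - t) *\<^sub>R x + t *\<^sub>R y) = (1 - t) * l x + t * l y"
        by (simp add: l_def inner_add_right algebra_simps)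
      then show "l ((1 - t) *\<^sub>R x + t *\<^sub>R y) / (- r) = (1 - t) * (l x / (- r)) + t * (l y / (- r))"
        by (simp add: add_divide_distrib)
    next
      fix x assume x: "x \<in> K"
      note l = l[OF x, THEN less_imp_le]
      show "b / (- r) \<le> l x / (- r)"
        using l(1) \<open>r < 0\<close> by (simp add: divide_right_mono_neg)
      show "(f x + f' x - 1) / 2 + b / (- r) \<le> l x / (- r)"
      proof -
        have "u + b / (- r) \<le> v / (- r)" if "b \<le> v + r * u" for u v
        proof -
          have "u + b / (- r) = (b - r * u) / (- r)" using \<open>r < 0\<close> by (simp add: field_simps)
          also have "\<dots> \<le> v / (- r)" using that \<open>r < 0\<close> by (intro divide_right_mono) auto
          finally show ?thesis .
        qed
        then show ?thesis using l(2) by blast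
      qed
      show "l x / (- r) + b / (- r) \<le> f x / 2 + 1 / 4"
        using l(4) \<open>r < 0\<close> by (simp add: field_simps)
      show "l x / (- r) + b / (- r) \<le> f' x / 2 + 1 / 4"
        using l(3) \<open>r < 0\<close> by (simp add: field_simps)
    qed
    then show False using mi by blast
  qed
qed (use witness_square_imp_maximally_incompatible[OF f] in blast)

section \<open>Transport of incompatibility and witness squares along a linear map injective on
  \<open>K\<close>\<close>

lemma effects_linear_vimage:
  assumes c: "linear c" and f: "f \<in> effects (c ` K)"
  shows "(\<lambda>x. f (c x)) \<in> effects K"
proof (rule effectsI)
  fix x y and t :: real assume "x \<in> K" "y \<in> K" "0 \<le> t" "t \<le> 1"
  then show "f (c ((1 - t) *\<^sub>R x + t *\<^sub>R y)) = (1 - t) * f (c x) + t * f (c y)"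
    using effects_affine[OF f, of "c x" "c y" t] by (simp add: linear_add[OF c] linear_scale[OF c])
qed (use effects_bounds[OF f] in auto)

lemma effects_inv_into:
  assumes c: "linear c" "inj_on c K" and f: "f \<in> effects K" and K: "convex K"
  shows "(\<lambda>y. f (inv_into K c y)) \<in> effects (c ` K)"
proof (rule effectsI)
  fix x y and t :: real assume x: "x \<in> c ` K" and y: "y \<in> c ` K" and t: "0 \<le> t" "t \<le> 1"
  from x y obtain x' y' where x': "x' \<in> K" "x = c x'" and y': "y' \<in> K" "y = c y'" by blast
  have "(1 - t) *\<^sub>R x' + t *\<^sub>R y' \<in> K" using K x' y' t by (simp add: convex_alt)
  moreover have "(1 - t) *\<^sub>R x + t *\<^sub>R y = c ((1 - t) *\<^sub>R x' + t *\<^sub>R y')"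
    by (simp add: x' y' linear_add[OF c(1)] linear_scale[OF c(1)])
  ultimately show "f (inv_into K c ((1 - t) *\<^sub>R x + t *\<^sub>R y)) =
      (1 - t) * f (inv_into K c x) + t * f (inv_into K c y)"
    using effects_affine[OF f x'(1) y'(1) t] x' y' by (simp add: inv_into_f_f[OF c(2)])
qed (use effects_bounds[OF f] in \<open>auto simp: inv_into_f_f[OF c(2)]\<close>)

lemma compatible_linear_image:
  assumes c: "linear c" "inj_on c K" and K: "convex K"
  shows "compatible (c ` K) g g' \<longleftrightarrow> compatible K (\<lambda>x. g (c x)) (\<lambda>x. g' (c x))"
proof
  assume "compatible (c ` K) g g'"
  then obtain p where "p \<in> effects (c ` K)"
    "\<forall>x\<in>c ` K. p x \<le> g x \<and> p x \<le> g' x \<and> g x + g' x \<le> 1 + p x"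
    by (auto simp: compatible_def)
  then show "compatible K (\<lambda>x. g (c x)) (\<lambda>x. g' (c x))"
    unfolding compatible_def
    by (intro bexI[of _ "\<lambda>x. p (c x)"] effects_linear_vimage[OF c(1)]) auto
next
  assume "compatible K (\<lambda>x. g (c x)) (\<lambda>x. g' (c x))"
  then obtain p where "p \<in> effects K"
    "\<forall>x\<in>K. p x \<le> g (c x) \<and> p x \<le> g' (c x) \<and> g (c x) + g' (c x) \<le> 1 + p x"
    by (auto simp: compatible_def)
  then show "compatible (c ` K) g g'"
    unfolding compatible_def
    by (intro bexI[of _ "\<lambda>y. p (inv_into K c y)"] effects_inv_into[OF c _ K])
      (auto simp: inv_into_f_f[OF c(2)])
qed

lemma maximally_incompatible_linear_image:
  assumes "linear c" "inj_on c K" "convex K"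
  shows "maximally_incompatible (c ` K) g g' \<longleftrightarrow> maximally_incompatible K (\<lambda>x. g (c x)) (\<lambda>x. g' (c x))"
  by (simp add: maximally_incompatible_def compatibility_degree_def compatible_linear_image[OF assms])

lemma witness_square_linear_image:
  assumes c: "linear c" "inj_on c K" and K: "convex K" and x: "\<And>i j. x i j \<in> K"
  shows "witness_square (c ` K) g g' (\<lambda>i j. c (x i j)) \<longleftrightarrow>
    witness_square K (\<lambda>x. g (c x)) (\<lambda>x. g' (c x)) x"
proof -
  \<comment> \<open>Injectivity is available on \<open>K\<close> only, so the midpoints must be
    known to lie there before \<open>c\<close> can be cancelled.\<close>
  have mid: "(1 / 2) *\<^sub>R (y + z) \<in> K" if "y \<in> K" "z \<in> K" for y z
    using convexD[OF K that, of "1 / 2" "1 / 2"] by (simp add: scaleR_add_right)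
  have "(1 / 2) *\<^sub>R (c (x 0 0) + c (x 1 1)) = (1 / 2) *\<^sub>R (c (x 1 0) + c (x 0 1)) \<longleftrightarrow>
      c ((1 / 2) *\<^sub>R (x 0 0 + x 1 1)) = c ((1 / 2) *\<^sub>R (x 1 0 + x 0 1))"
    by (simp only: linear_add[OF c(1)] linear_scale[OF c(1)])
  also have "\<dots> \<longleftrightarrow> (1 / 2) *\<^sub>R (x 0 0 + x 1 1) = (1 / 2) *\<^sub>R (x 1 0 + x 0 1)"
    using inj_on_eq_iff[OF c(2)] mid x by blast
  finally show ?thesis using x by (simp add: witness_square_def)
qed

section \<open>Tensor products and Choi matrices\<close>

lemma sum_UNIV_prod: "(\<Sum>p\<in>UNIV. f p) = (\<Sum>a\<in>UNIV. \<Sum>b\<in>UNIV. f (a, b))"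
  by (simp add: sum.cartesian_product)

lemma kron_mult: "kron A B ** kron C D = kron (A ** C) (B ** D)"
  for A C :: "complex^'m::finite^'m" and B D :: "complex^'n::finite^'n"
  by (simp add: vec_eq_iff kron_def matrix_matrix_mult_def sum_UNIV_prod sum_product mult_ac)

lemma kron_mat_1: "kron (mat 1) (mat 1) = mat 1"
  by (auto simp: vec_eq_iff kron_def mat_def)

lemma cadjoint_kron: "cadjoint (kron A B) = kron (cadjoint A) (cadjoint B)"
  by (simp add: vec_eq_iff kron_def cadjoint_def)

lemma kron_mult_vec: "kron A B *v kron_vec v w = kron_vec (A *v v) (B *v w)"
  for A :: "complex^'m::finite^'m" and B :: "complex^'n::finite^'n"
  by (simp add: vec_eq_iff kron_def kron_vec_def matrix_vector_mult_def sum_UNIV_prod sum_product mult_ac)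

lemma cinner_kron_vec: "cinner (kron_vec v w) (kron_vec v' w') = cinner v v' * cinner w w'"
  by (simp add: cinner_def kron_vec_def sum_UNIV_prod sum_product mult_ac)

lemma proj_kron_vec: "proj (kron_vec v w) = kron (proj v) (proj w)"
  by (simp add: vec_eq_iff ketbra_def kron_def kron_vec_def)

lemma kron_add_left: "kron (A + B) C = kron A C + kron B C"
  by (simp add: vec_eq_iff kron_def algebra_simps)

lemma kron_add_right: "kron C (A + B) = kron C A + kron C B"
  by (simp add: vec_eq_iff kron_def algebra_simps)

lemma kron_zero_left [simp]: "kron 0 A = 0"
  by (simp add: vec_eq_iff kron_def)

lemma kron_vec_diff_right: "kron_vec v (x - y) = kron_vec v x - kron_vec v y"
  and kron_vec_scale_right: "kron_vec v (c *s x) = c *s kron_vec v x"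
  by (simp_all add: vec_eq_iff kron_vec_def algebra_simps)

lemma psd_kron_proj:
  assumes "psd (A :: complex^'m^'m::finite)"
  shows "psd (kron A (proj w))"
proof -
  obtain v :: "'m \<Rightarrow> complex^'m" where v: "A = (\<Sum>i\<in>UNIV. proj (v i))" using psd_sum_proj[OF assms] .
  have "kron (\<Sum>i\<in>S. proj (v i)) (proj w) = (\<Sum>i\<in>S. kron (proj (v i)) (proj w))" for S
    by (induction S rule: infinite_finite_induct) (simp_all add: kron_add_left)
  then show ?thesis
    by (auto simp: v proj_kron_vec[symmetric] intro!: psd_sum psd_proj)
qed

definition partial_trace_out :: "complex^('m::finite \<times> 'n)^('m \<times> 'n) \<Rightarrow> complex^'n^'n" where
  "partial_trace_out C = (\<chi> i j. \<Sum>a\<in>UNIV. C $ (a, i) $ (a, j))"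

definition choi_matrices :: "(complex^('m::finite \<times> 'n::finite)^('m \<times> 'n)) set" where
  "choi_matrices = {C. psd C \<and> partial_trace_out C = mat 1}"

lemma trace_mult_kron_mat_1: "trace (C ** kron (mat 1) \<sigma>) = trace (partial_trace_out C ** \<sigma>)"
proof -
  have inner: "(\<Sum>b\<in>UNIV. \<Sum>n\<in>UNIV. C $ (a, m) $ (b, n) * (mat 1 $ b $ a * \<sigma> $ n $ m)) =
      (\<Sum>n\<in>UNIV. C $ (a, m) $ (a, n) * \<sigma> $ n $ m)" for a m
    by (subst sum.swap)
      (simp add: mat_def if_distrib[of "\<lambda>x. x * _"] if_distrib[of "\<lambda>x. _ * x"] cong: if_cong)
  have "trace (C ** kron (mat 1) \<sigma>) = (\<Sum>a\<in>UNIV. \<Sum>m\<in>UNIV. \<Sum>n\<in>UNIV. C $ (a, m) $ (a, n) * \<sigma> $ n $ m)"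
    by (simp add: trace_def matrix_matrix_mult_def kron_def sum_UNIV_prod inner)
  also have "\<dots> = (\<Sum>m\<in>UNIV. \<Sum>n\<in>UNIV. \<Sum>a\<in>UNIV. C $ (a, m) $ (a, n) * \<sigma> $ n $ m)"
    by (subst sum.swap, rule sum.cong[OF refl], rule sum.swap)
  also have "\<dots> = trace (partial_trace_out C ** \<sigma>)"
    by (simp add: trace_def matrix_matrix_mult_def partial_trace_out_def sum_distrib_right)
  finally show ?thesis .
qed

text \<open>Matrix units as test operators recover the entries of the partial trace. The dual form
  reduces later membership proofs to cyclicity of the trace and rank-one computations.\<close>

lemma partial_trace_out_eq_iff:
  "partial_trace_out C = mat 1 \<longleftrightarrow> (\<forall>\<sigma>. trace (C ** kron (mat 1) \<sigma>) = trace \<sigma>)"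
proof
  assume *: "\<forall>\<sigma>. trace (C ** kron (mat 1) \<sigma>) = trace \<sigma>"
  have "partial_trace_out C $ n $ m = mat 1 $ n $ m" for n m
  proof -
    have "cinner (ket n) (partial_trace_out C *v ket m) = cinner (ket n) (ket m)"
      using *[rule_format, of "ketbra (ket m) (ket n)"]
      by (simp add: trace_mult_kron_mat_1 mult_ketbra trace_ketbra del: cinner_ket_left)
    then show ?thesis by (simp add: matrix_vector_ket) (simp add: ket_def axis_def mat_def)
  qed
  then show "partial_trace_out C = mat 1" by (simp add: vec_eq_iff)
qed (simp add: trace_mult_kron_mat_1)

section \<open>Conjugation by unitaries and by their tensor products\<close>

lemma unitary_kron: "unitary U \<Longrightarrow> unitary V \<Longrightarrow> unitary (kron U V)"
  by (simp add: unitary_def cadjoint_kron kron_mult kron_mat_1)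

lemma unitary_cadjoint: "unitary U \<Longrightarrow> unitary (cadjoint U)"
  by (simp add: unitary_def)

lemma conjugate_by_cadjoint:
  assumes "unitary U"
  shows "conjugate_by (cadjoint U) (conjugate_by U A) = A"
proof -
  have "conjugate_by (cadjoint U) (conjugate_by U A) = (cadjoint U ** U) ** A ** (cadjoint U ** U)"
    by (simp add: conjugate_by_def matrix_mul_assoc)
  then show ?thesis using assms by (simp add: unitary_def)
qed

lemma conjugate_by_inject:
  "unitary U \<Longrightarrow> conjugate_by U A = conjugate_by U B \<Longrightarrow> A = B"
  by (metis conjugate_by_cadjoint)

lemma conjugate_by_mult:
  assumes "unitary U"
  shows "conjugate_by U A ** conjugate_by U B = conjugate_by U (A ** B)"
proof -
  have "conjugate_by U A ** conjugate_by U B = U ** A ** (cadjoint U ** U) ** B ** cadjoint U"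
    by (simp only: conjugate_by_def matrix_mul_assoc)
  also have "\<dots> = U ** A ** B ** cadjoint U"
    using assms by (simp only: unitary_def matrix_mul_rid)
  finally show ?thesis by (simp only: conjugate_by_def matrix_mul_assoc)
qed

lemma trace_conjugate_by:
  assumes "unitary U"
  shows "trace (conjugate_by U A) = trace A"
proof -
  have "trace (conjugate_by U A) = trace (cadjoint U ** (U ** A))"
    unfolding conjugate_by_def by (rule trace_mul_sym)
  then show ?thesis using assms by (simp add: matrix_mul_assoc unitary_def)
qed

lemma conjugate_by_add: "conjugate_by U (A + B) = conjugate_by U A + conjugate_by U B"
  by (simp add: conjugate_by_def matrix_mult_add_left matrix_add_ldistrib)

lemma conjugate_by_kron:
  "conjugate_by (kron U V) (kron A B) = kron (conjugate_by U A) (conjugate_by V B)"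
  by (simp add: conjugate_by_def cadjoint_kron kron_mult)

lemma conjugate_by_proj: "conjugate_by U (proj v) = proj (U *v v)"
  by (simp add: conjugate_by_def mult_ketbra ketbra_mult)

lemma conjugate_by_choi_matrices:
  assumes "unitary U" "unitary V" "C \<in> choi_matrices"
  shows "conjugate_by (kron U V) C \<in> choi_matrices"
proof -
  have "trace (conjugate_by (kron U V) C ** kron (mat 1) \<sigma>) = trace \<sigma>" for \<sigma>
  proof -
    \<comment> \<open>The output unitary fixes the identity, so the conjugation can be moved onto
      the test operator alone, where it preserves the trace.\<close>
    have "kron (mat 1) \<sigma> = conjugate_by (kron U V) (kron (mat 1) (conjugate_by (cadjoint V) \<sigma>))"
      using assms conjugate_by_cadjoint[OF unitary_cadjoint[OF assms(2)], of \<sigma>]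
      by (simp add: conjugate_by_kron, simp add: conjugate_by_def unitary_def)
    then have "trace (conjugate_by (kron U V) C ** kron (mat 1) \<sigma>) =
        trace (C ** kron (mat 1) (conjugate_by (cadjoint V) \<sigma>))"
      using assms by (simp add: conjugate_by_mult unitary_kron trace_conjugate_by)
    also have "\<dots> = trace \<sigma>"
      using assms partial_trace_out_eq_iff[of C]
      by (simp add: choi_matrices_def trace_conjugate_by unitary_cadjoint)
    finally show ?thesis .
  qed
  then show ?thesis
    using assms psd_conjugate by (auto simp: choi_matrices_def partial_trace_out_eq_iff)
qed

section \<open>Convexity, compactness and nonemptiness of the set of Choi matrices\<close>

lemma convex_choi_matrices: "convex choi_matrices"
  unfolding convex_alt
proof (intro ballI allI impI)
  fix A B :: "complex^('a \<times> 'b)^('a \<times> 'b)" and t :: real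
  assume A: "A \<in> choi_matrices" and B: "B \<in> choi_matrices" and t: "0 \<le> t \<and> t \<le> 1"
  have scale: "cinner v ((r *\<^sub>R C) *v v) = of_real r * cinner v (C *v v)"
    for r v and C :: "complex^('a \<times> 'b)^('a \<times> 'b)"
    by (simp add: cinner_def matrix_vector_mult_def scaleR_conv_of_real[where 'a = complex] sum_distrib_left mult_ac)
  have psd_scale: "psd (r *\<^sub>R C)" if "0 \<le> r" "psd C" for r and C :: "complex^('a \<times> 'b)^('a \<times> 'b)"
    using that unfolding psd_def scale by (simp add: less_eq_complex_def)
  have "partial_trace_out ((1 - t) *\<^sub>R A + t *\<^sub>R B) = (1 - t) *\<^sub>R partial_trace_out A + t *\<^sub>R partial_trace_out B"
    by (simp add: partial_trace_out_def vec_eq_iff sum.distrib scaleR_sum_right)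
  also have "\<dots> = mat 1"
    using A B by (simp add: choi_matrices_def algebra_simps)
  finally show "(1 - t) *\<^sub>R A + t *\<^sub>R B \<in> choi_matrices"
    using A B t by (simp add: choi_matrices_def psd_add psd_scale)
qed

text \<open>Positivity at \<open>ket p + c *s ket q\<close>, with the phase \<open>c\<close> chosen
  so that both cross terms equal minus the modulus of the entry.\<close>

lemma psd_norm_entry_le:
  assumes "psd A"
  shows "2 * cmod (A $ p $ q) \<le> Re (A $ p $ p) + Re (A $ q $ q)"
proof -
  \<comment> \<open>If the entry is zero then \<open>sgn\<close> gives \<open>c = 0\<close>; hence
    only \<open>(cmod c)\<^sup>2 \<le> 1\<close> is used below.\<close>
  define c where "c = - cnj (sgn (A $ p $ q))"
  have qp: "A $ q $ p = cnj (A $ p $ q)"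
    using psd_hermitian[OF assms] by (simp add: cadjoint_def vec_eq_iff)
  have c: "c * A $ p $ q = - of_real (cmod (A $ p $ q))"
    by (simp add: c_def sgn_div_norm scaleR_conv_of_real complex_norm_square[symmetric] field_simps power2_eq_square)
  then have c': "cnj c * A $ q $ p = - of_real (cmod (A $ p $ q))"
    by (metis qp complex_cnj_mult complex_cnj_minus complex_cnj_complex_of_real)
  have "0 \<le> A $ q $ q" "0 \<le> A $ p $ p"
    using psdD[OF assms, of "ket q"] psdD[OF assms, of "ket p"] by (simp_all add: matrix_vector_ket)
  moreover have "c * cnj c = of_real ((cmod c)\<^sup>2)"
    by (rule complex_norm_square[symmetric, folded of_real_power])
  moreover have "(cmod c)\<^sup>2 \<le> 1"
    by (simp add: c_def norm_sgn)
  ultimately have "Re (c * cnj c * A $ q $ q) \<le> Re (A $ q $ q)"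
    by (simp add: less_eq_complex_def mult_left_le_one_le del: of_real_power)
  moreover have "0 \<le> Re (cinner (ket p + c *s ket q) (A *v (ket p + c *s ket q)))"
    using psdD[OF assms] by (simp only: less_eq_complex_def zero_complex.simps)
  ultimately show ?thesis
    unfolding quadratic_form_add by (simp add: matrix_vector_ket c c')
qed

lemma norm_vec_le_sum: "norm x \<le> (\<Sum>i\<in>UNIV. norm (x $ i))"
  by (simp add: norm_vec_def L2_set_le_sum)

text \<open>The diagonal entries are nonnegative and sum to the input dimension, and they dominate
  all other entries. Closedness holds because membership is an intersection of closed conditions on
  the entries.\<close>

lemma compact_choi_matrices:
  "compact (choi_matrices :: (complex^('m::finite \<times> 'n::finite)^('m \<times> 'n)) set)"
proof -
  let ?K = "choi_matrices :: (complex^('m \<times> 'n)^('m \<times> 'n)) set"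
  have "norm (C $ p $ q) \<le> CARD('n)" if C: "C \<in> ?K" for C p q
  proof -
    have diag: "0 \<le> Re (C $ r $ r)" for r
      using C psdD[of C "ket r"] by (simp add: choi_matrices_def matrix_vector_ket less_eq_complex_def)
    have "trace C = CARD('n)"
      using C partial_trace_out_eq_iff[of C] trace_I
      by (auto simp: choi_matrices_def kron_mat_1 dest!: spec[of _ "mat 1"])
    then have "(\<Sum>r\<in>UNIV. Re (C $ r $ r)) = CARD('n)"
      by (metis trace_def Re_sum of_nat_eq_iff complex.sel(1) of_real_of_nat_eq Re_complex_of_real)
    then have "Re (C $ r $ r) \<le> CARD('n)" for r
      using member_le_sum[of r UNIV "\<lambda>r. Re (C $ r $ r)"] diag by simp
    from this[of p] this[of q] show ?thesis
      using psd_norm_entry_le[of C p q] C by (simp add: choi_matrices_def)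
  qed
  then have "norm C \<le> (\<Sum>p\<in>(UNIV :: ('m \<times> 'n) set). \<Sum>q\<in>(UNIV :: ('m \<times> 'n) set). real CARD('n))"
    if "C \<in> ?K" for C
    using norm_vec_le_sum[of C] that
    by (rule_tac order_trans[OF norm_vec_le_sum]) (blast intro: sum_mono order_trans[OF norm_vec_le_sum])
  then have "bounded ?K" unfolding bounded_iff by blast
  moreover have "closed ?K"
  proof -
    have quad: "continuous_on UNIV (\<lambda>C. cinner v (C *v v))" for v :: "complex^('m \<times> 'n)"
      unfolding cinner_def matrix_vector_mult_def by (simp, intro continuous_intros)
    have "?K = (\<Inter>v. {C. 0 \<le> Re (cinner v (C *v v))} \<inter> {C. Im (cinner v (C *v v)) = 0}) \<inter>
        (\<Inter>i. \<Inter>j. {C. (\<Sum>a\<in>UNIV. C $ (a, i) $ (a, j)) = mat 1 $ i $ j})"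
      by (auto simp: choi_matrices_def psd_def less_eq_complex_def partial_trace_out_def vec_eq_iff)
    moreover have "closed \<dots>"
      by (intro closed_Int closed_INT ballI closed_Collect_le closed_Collect_eq
          continuous_on_Re continuous_on_Im continuous_on_const quad continuous_on_sum
          continuous_on_component continuous_on_id)
    ultimately show ?thesis by simp
  qed
  ultimately show ?thesis by (simp add: compact_eq_bounded_closed)
qed

text \<open>The witness is \<open>proj (ket a)\<close> tensored with the identity, the Choi matrix
  of the channel that discards its input and prepares \<open>ket a\<close>.\<close>

lemma choi_matrices_nonempty:
  "choi_matrices \<noteq> ({} :: (complex^('m::finite \<times> 'n::finite)^('m \<times> 'n)) set)"
proof -
  fix a :: 'm
  have "trace ((\<Sum>n\<in>(UNIV :: 'n set). proj (kron_vec (ket a) (ket n))) ** kron (mat 1) \<sigma>) = trace \<sigma>" for \<sigma>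
    by (subst trace_mul_sym)
      (simp add: matrix_mult_sum trace_sum trace_mult_proj kron_mult_vec cinner_kron_vec matrix_vector_ket,
        simp add: ket_def trace_def)
  then have "(\<Sum>n\<in>(UNIV :: 'n set). proj (kron_vec (ket a) (ket n))) \<in> choi_matrices"
    by (simp add: choi_matrices_def psd_sum psd_proj partial_trace_out_eq_iff)
  then show ?thesis by blast
qed

section \<open>The Choi isomorphism\<close>

lemma psi_plus_nth: "psi_plus $ (a, m) = of_bool (a = m)"
  by (simp add: psi_plus_def sum_component kron_vec_def ket_def axis_def if_distrib[of "\<lambda>x. x * _"]
      if_distrib[of "\<lambda>x. _ * x"] cong: if_cong)

lemma choi_nth: "choi \<Phi> $ (a, m) $ (b, n) = \<Phi> (ketbra (ket m) (ket n)) $ a $ b"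
proof -
  have "(\<chi> a b. proj psi_plus $ (a, m) $ (b, n)) = ketbra (ket m) (ket n)"
    by (simp add: vec_eq_iff ketbra_def psi_plus_nth ket_def axis_def)
  then show ?thesis by (simp add: choi_def ampliate_def)
qed

lemma linear_choi: "linear choi"
  by (rule linearI) (simp_all add: vec_eq_iff choi_nth blinfun.add_left blinfun.scaleR_left)

lemma vector_space_mscale: "vector_space mscale"
  by unfold_locales (simp_all add: vec_eq_iff mscale_def algebra_simps)

lemma matrix_eq_sum_ketbra:
  "A = (\<Sum>m\<in>UNIV. \<Sum>n\<in>UNIV. mscale (A $ m $ n) (ketbra (ket m) (ket n)))"
  by (simp add: vec_eq_iff sum_component mscale_def ketbra_def ket_def axis_def if_distrib[of cnj]
      if_distrib[of "\<lambda>x. x * _"] if_distrib[of "\<lambda>x. _ * x"] cong: if_cong)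

lemma mscale_linear_apply:
  fixes \<Phi> :: "complex^'n^'n::finite \<Rightarrow> complex^'m^'m::finite"
  assumes "Vector_Spaces.linear mscale mscale \<Phi>"
  shows "\<Phi> A = (\<Sum>m\<in>UNIV. \<Sum>n\<in>UNIV. mscale (A $ m $ n) (\<Phi> (ketbra (ket m) (ket n))))"
proof -
  have add: "\<Phi> (x + y) = \<Phi> x + \<Phi> y" and scale: "\<Phi> (mscale c x) = mscale c (\<Phi> x)" for c x y
    using assms by (simp_all add: Vector_Spaces.linear_iff)
  have zero: "\<Phi> 0 = 0" using add[of 0 0] by simp
  have sum: "\<Phi> (\<Sum>i\<in>S. f i) = (\<Sum>i\<in>S. \<Phi> (f i))" for S :: "'n set" and f
    by (induction S rule: infinite_finite_induct) (simp_all add: add zero)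
  show ?thesis
    using arg_cong[OF matrix_eq_sum_ketbra[of A], of \<Phi>] by (simp only: sum scale)
qed

lemma channel_apply_nth:
  assumes "\<Phi> \<in> channels"
  shows "\<Phi> A $ a $ b = (\<Sum>m\<in>UNIV. \<Sum>n\<in>UNIV. A $ m $ n * choi \<Phi> $ (a, m) $ (b, n))"
  using assms
  by (subst mscale_linear_apply) (simp_all add: channels_def sum_component mscale_def choi_nth)

lemma inj_on_choi: "inj_on choi channels"
proof (rule inj_onI)
  fix \<Phi> \<Psi> :: "(complex^'a^'a) \<Rightarrow>\<^sub>L (complex^'b^'b)"
  assume "\<Phi> \<in> channels" "\<Psi> \<in> channels" "choi \<Phi> = choi \<Psi>"
  then show "\<Phi> = \<Psi>"
    by (intro blinfun_eqI) (simp add: vec_eq_iff channel_apply_nth)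
qed

lemma convex_channels: "convex channels"
  unfolding convex_alt
proof (intro ballI allI impI)
  fix \<Phi> \<Psi> :: "(complex^'a^'a) \<Rightarrow>\<^sub>L (complex^'b^'b)" and t :: real
  assume \<Phi>: "\<Phi> \<in> channels" and \<Psi>: "\<Psi> \<in> channels" and t: "0 \<le> t \<and> t \<le> 1"
  let ?X = "(1 - t) *\<^sub>R \<Phi> + t *\<^sub>R \<Psi>"
  have app: "?X A = (1 - t) *\<^sub>R \<Phi> A + t *\<^sub>R \<Psi> A" for A
    by (simp add: blinfun.add_left blinfun.scaleR_left)
  have scale: "cinner v ((r *\<^sub>R C) *v w) = of_real r * cinner v (C *v w)"
    for r v w and C :: "complex^'b^'b"
    by (simp add: cinner_def matrix_vector_mult_def scaleR_conv_of_real[where 'a = complex] sum_distrib_left mult_ac)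
  have lin: "Vector_Spaces.linear mscale mscale (blinfun_apply \<Phi>)" "Vector_Spaces.linear mscale mscale (blinfun_apply \<Psi>)"
    using \<Phi> \<Psi> by (simp_all add: channels_def)
  have mscale: "r *\<^sub>R mscale c C = mscale c (r *\<^sub>R C)" for r c and C :: "complex^'b^'b"
    by (simp add: mscale_def vec_eq_iff)
  have madd: "mscale c A + mscale c B = mscale c (A + B)" for c and A B :: "complex^'b^'b"
    by (simp add: mscale_def vec_eq_iff algebra_simps)
  have "Vector_Spaces.linear mscale mscale ?X"
    using lin by (simp add: Vector_Spaces.linear_iff app blinfun.add_right scaleR_add_right mscale madd)
  moreover have "completely_positive ?X"
    unfolding completely_positive_def
  proof (intro allI impI)
    fix k X assume X: "block_psd k (X :: nat \<Rightarrow> nat \<Rightarrow> complex^'a^'a)"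
    have pos: "block_psd k (\<lambda>i j. \<Phi> (X i j))" "block_psd k (\<lambda>i j. \<Psi> (X i j))"
      using \<Phi> \<Psi> X by (auto simp: channels_def completely_positive_def)
    have "(\<Sum>i<k. \<Sum>j<k. cinner (v i) (?X (X i j) *v v j)) =
        of_real (1 - t) * (\<Sum>i<k. \<Sum>j<k. cinner (v i) (\<Phi> (X i j) *v v j)) +
        of_real t * (\<Sum>i<k. \<Sum>j<k. cinner (v i) (\<Psi> (X i j) *v v j))" for v
      by (simp only: app matrix_vector_mult_add_rdistrib cinner_add_right scale sum.distrib sum_distrib_left)
    moreover have "0 \<le> of_real (1 - t) * (\<Sum>i<k. \<Sum>j<k. cinner (v i) (\<Phi> (X i j) *v v j)) +
        of_real t * (\<Sum>i<k. \<Sum>j<k. cinner (v i) (\<Psi> (X i j) *v v j))" for v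
      using pos t unfolding block_psd_def
      by (intro add_nonneg_nonneg mult_nonneg_nonneg) (auto simp: less_eq_complex_def)
    ultimately show "block_psd k (\<lambda>i j. ?X (X i j))"
      unfolding block_psd_def by simp
  qed
  moreover have "trace_preserving ?X"
    unfolding trace_preserving_def
  proof
    fix A
    have "trace (?X A) = of_real (1 - t) * trace (\<Phi> A) + of_real t * trace (\<Psi> A)"
      by (simp only: app trace_def vector_add_component vector_scaleR_component
          scaleR_conv_of_real[where 'a = complex] sum.distrib sum_distrib_left)
    then show "trace (?X A) = trace A"
      using \<Phi> \<Psi> by (simp add: channels_def trace_preserving_def algebra_simps)
  qed
  ultimately show "?X \<in> channels"
    by (simp add: channels_def)
qed

text \<open>The block matrix of all matrix units is positive, its quadratic form being the squared
  modulus of one sum, so an ancilla of the input dimension suffices. Blocks are indexed by naturals,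
  hence the enumeration \<open>h\<close> of the input basis.\<close>

lemma completely_positive_choi_psd:
  fixes \<Phi> :: "(complex^'n^'n::finite) \<Rightarrow>\<^sub>L (complex^'m^'m::finite)"
  assumes "completely_positive \<Phi>"
  shows "psd (choi \<Phi>)"
  unfolding psd_def
proof
  fix v :: "complex^('m \<times> 'n)"
  let ?k = "CARD('n)"
  obtain h where h: "bij_betw h {..<?k} (UNIV :: 'n set)"
    using ex_bij_betw_nat_finite[of "UNIV :: 'n set"] by (auto simp: lessThan_atLeast0)
  have reindex: "(\<Sum>i<?k. \<Sum>j<?k. G (h i) (h j)) = (\<Sum>m\<in>UNIV. \<Sum>n\<in>UNIV. G m n)"
    for G :: "'n \<Rightarrow> 'n \<Rightarrow> complex"
  proof -
    have "(\<Sum>i<?k. \<Sum>j<?k. G (h i) (h j)) = (\<Sum>i<?k. \<Sum>n\<in>UNIV. G (h i) n)"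
      by (intro sum.cong refl sum.reindex_bij_betw[OF h])
    also have "\<dots> = (\<Sum>m\<in>UNIV. \<Sum>n\<in>UNIV. G m n)"
      by (rule sum.reindex_bij_betw[OF h])
    finally show ?thesis .
  qed
  have "block_psd ?k (\<lambda>i j. ketbra (ket (h i)) (ket (h j)))"
    unfolding block_psd_def
  proof
    fix y :: "nat \<Rightarrow> complex^'n"
    have "cinner (y i) (ketbra (ket (h i)) (ket (h j)) *v y j) = cnj (y i $ h i) * y j $ h j" for i j
      using cinner_commute[of "ket (h i)" "y i"]
      by (simp add: ketbra_mult_vec cinner_scale_right)
    then have "(\<Sum>i<?k. \<Sum>j<?k. cinner (y i) (ketbra (ket (h i)) (ket (h j)) *v y j)) =
        cnj (\<Sum>i<?k. y i $ h i) * (\<Sum>i<?k. y i $ h i)"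
      by (simp add: sum_product)
    also have "0 \<le> \<dots>"
      by (simp add: mult.commute[of "cnj _"] complex_mult_cnj less_eq_complex_def del: cnj_sum)
    finally show "0 \<le> (\<Sum>i<?k. \<Sum>j<?k. cinner (y i) (ketbra (ket (h i)) (ket (h j)) *v y j))" .
  qed
  then have "block_psd ?k (\<lambda>i j. \<Phi> (ketbra (ket (h i)) (ket (h j))))"
    using assms unfolding completely_positive_def by blast
  \<comment> \<open>The vector \<open>v\<close> is cut into slices along the input index, one for
    each block.\<close>
  then have "0 \<le> (\<Sum>i<?k. \<Sum>j<?k. cinner (\<chi> a. v $ (a, h i)) (\<Phi> (ketbra (ket (h i)) (ket (h j))) *v (\<chi> a. v $ (a, h j))))"
    unfolding block_psd_def by (rule spec)
  also have "\<dots> = (\<Sum>m\<in>UNIV. \<Sum>n\<in>UNIV. cinner (\<chi> a. v $ (a, m)) (\<Phi> (ketbra (ket m) (ket n)) *v (\<chi> a. v $ (a, n))))"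
    by (rule reindex)
  also have "\<dots> = (\<Sum>m\<in>UNIV. \<Sum>a\<in>UNIV. \<Sum>n\<in>UNIV. \<Sum>b\<in>UNIV. cnj (v $ (a, m)) * (choi \<Phi> $ (a, m) $ (b, n) * v $ (b, n)))"
    by (rule sum.cong[OF refl], subst sum.swap)
      (simp add: cinner_def matrix_vector_mult_def sum_distrib_left choi_nth)
  also have "\<dots> = (\<Sum>a\<in>UNIV. \<Sum>m\<in>UNIV. \<Sum>b\<in>UNIV. \<Sum>n\<in>UNIV. cnj (v $ (a, m)) * (choi \<Phi> $ (a, m) $ (b, n) * v $ (b, n)))"
    by (subst sum.swap) (intro sum.cong refl sum.swap)
  also have "\<dots> = cinner v (choi \<Phi> *v v)"
    by (simp add: cinner_def matrix_vector_mult_def sum_UNIV_prod sum_distrib_left)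
  finally show "0 \<le> cinner v (choi \<Phi> *v v)" .
qed

lemma choi_in_choi_matrices:
  assumes "\<Phi> \<in> channels"
  shows "choi \<Phi> \<in> choi_matrices"
proof -
  have "partial_trace_out (choi \<Phi>) $ m $ n = mat 1 $ m $ n" for m n
  proof -
    have "partial_trace_out (choi \<Phi>) $ m $ n = trace (\<Phi> (ketbra (ket m) (ket n)))"
      by (simp add: partial_trace_out_def choi_nth trace_def)
    also have "\<dots> = trace (ketbra (ket m) (ket n))"
      using assms by (simp add: channels_def trace_preserving_def)
    finally show ?thesis by (simp add: trace_ketbra, simp add: ket_def axis_def mat_def)
  qed
  then show ?thesis
    using assms completely_positive_choi_psd
    by (auto simp: choi_matrices_def channels_def vec_eq_iff)
qed

text \<open>The inverse Choi correspondence: the partial trace over the input of \<open>C\<close>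
  times the identity tensored with the transpose of \<open>A\<close>.\<close>

definition choi_map :: "complex^('m::finite \<times> 'n::finite)^('m \<times> 'n) \<Rightarrow> complex^'n^'n \<Rightarrow> complex^'m^'m" where
  "choi_map C A = (\<chi> a b. \<Sum>m\<in>UNIV. \<Sum>n\<in>UNIV. A $ m $ n * C $ (a, m) $ (b, n))"

lemma bounded_linear_choi_map: "bounded_linear (choi_map C)"
  unfolding linear_conv_bounded_linear[symmetric]
  by (rule linearI)
    (simp_all add: choi_map_def vec_eq_iff algebra_simps sum.distrib scaleR_sum_right)

lemma choi_map_linear: "Vector_Spaces.linear mscale mscale (choi_map C)"
  by (simp add: Vector_Spaces.linear_iff vector_space_mscale)
    (simp add: choi_map_def vec_eq_iff mscale_def algebra_simps sum.distrib sum_distrib_left)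

text \<open>A rank-one summand of the Choi matrix is a Kraus operator of the map.\<close>

lemma choi_map_proj:
  "choi_map (proj w) A = (\<chi> a m. w $ (a, m)) ** A ** cadjoint (\<chi> a m. w $ (a, m))"
proof -
  have "(\<Sum>m\<in>UNIV. \<Sum>n\<in>UNIV. A $ m $ n * (w $ (a, m) * cnj (w $ (b, n)))) =
      (\<Sum>n\<in>UNIV. (\<Sum>m\<in>UNIV. w $ (a, m) * A $ m $ n) * cnj (w $ (b, n)))" for a b
    by (subst sum.swap) (simp add: sum_distrib_left sum_distrib_right mult_ac)
  then show ?thesis
    by (simp add: vec_eq_iff choi_map_def matrix_matrix_mult_def cadjoint_def ketbra_def)
qed

lemma choi_map_sum: "choi_map (\<Sum>i\<in>S. f i) A = (\<Sum>i\<in>S. choi_map (f i) A)"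
  by (induction S rule: infinite_finite_induct)
    (simp_all add: choi_map_def vec_eq_iff algebra_simps sum.distrib)

text \<open>In Kraus form each operator moves from the blocks onto the test vectors, so block
  positivity of \<open>X\<close> applies termwise.\<close>

lemma completely_positive_choi_map:
  fixes C :: "complex^('m::finite \<times> 'n::finite)^('m \<times> 'n)"
  assumes "psd C"
  shows "completely_positive (choi_map C)"
  unfolding completely_positive_def
proof (intro allI impI)
  fix k and X :: "nat \<Rightarrow> nat \<Rightarrow> complex^'n^'n" assume X: "block_psd k X"
  obtain w :: "('m \<times> 'n) \<Rightarrow> complex^('m \<times> 'n)" where w: "C = (\<Sum>p\<in>UNIV. proj (w p))"
    using psd_sum_proj[OF assms] .
  define W :: "('m \<times> 'n) \<Rightarrow> complex^'n^'m" where "W p = (\<chi> a m. w p $ (a, m))" for p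
  have vec_sum: "(\<Sum>p\<in>S. f p) *v v = (\<Sum>p\<in>S. f p *v v)" for S :: "('m \<times> 'n) set" and f :: "_ \<Rightarrow> complex^'m^'m" and v
    by (induction S rule: infinite_finite_induct) (simp_all add: matrix_vector_mult_add_rdistrib)
  have "cinner u (choi_map C A *v v) = (\<Sum>p\<in>UNIV. cinner (cadjoint (W p) *v u) (A *v (cadjoint (W p) *v v)))" for u v A
    by (simp add: w choi_map_sum choi_map_proj vec_sum cinner_sum_right W_def[symmetric]
        matrix_vector_mul_assoc[symmetric] cinner_mult_right[of u])
  then have "(\<Sum>i<k. \<Sum>j<k. cinner (v i) (choi_map C (X i j) *v v j)) =
      (\<Sum>p\<in>UNIV. \<Sum>i<k. \<Sum>j<k. cinner (cadjoint (W p) *v v i) (X i j *v (cadjoint (W p) *v v j)))" for v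
    by (simp add: sum.swap[of _ "UNIV :: ('m \<times> 'n) set"])
  moreover have "0 \<le> (\<Sum>i<k. \<Sum>j<k. cinner (cadjoint (W p) *v v i) (X i j *v (cadjoint (W p) *v v j)))" for v p
    using X[unfolded block_psd_def, rule_format, of "\<lambda>i. cadjoint (W p) *v v i"] .
  ultimately show "block_psd k (\<lambda>i j. choi_map C (X i j))"
    unfolding block_psd_def by (simp add: sum_nonneg)
qed

lemma trace_preserving_choi_map:
  assumes "partial_trace_out C = mat 1"
  shows "trace_preserving (choi_map C)"
  unfolding trace_preserving_def
proof
  fix A
  have C: "(\<Sum>a\<in>UNIV. C $ (a, m) $ (a, n)) = mat 1 $ m $ n" for m n
    using assms by (simp add: partial_trace_out_def vec_eq_iff)
  have "trace (choi_map C A) = (\<Sum>m\<in>UNIV. \<Sum>a\<in>UNIV. \<Sum>n\<in>UNIV. A $ m $ n * C $ (a, m) $ (a, n))"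
    by (simp add: trace_def choi_map_def) (rule sum.swap)
  also have "\<dots> = (\<Sum>m\<in>UNIV. \<Sum>n\<in>UNIV. \<Sum>a\<in>UNIV. A $ m $ n * C $ (a, m) $ (a, n))"
    by (intro sum.cong refl sum.swap)
  also have "\<dots> = (\<Sum>m\<in>UNIV. \<Sum>n\<in>UNIV. A $ m $ n * mat 1 $ m $ n)"
    by (simp add: sum_distrib_left[symmetric] C)
  also have "\<dots> = trace A"
    by (simp add: mat_def trace_def if_distrib[of "\<lambda>x. _ * x"] cong: if_cong)
  finally show "trace (choi_map C A) = trace A" .
qed

lemma choi_map_channel:
  assumes "C \<in> choi_matrices"
  shows "\<exists>\<Phi>\<in>channels. choi \<Phi> = C"
proof
  let ?\<Phi> = "Blinfun (choi_map C)"
  have app: "blinfun_apply ?\<Phi> = choi_map C"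
    by (rule bounded_linear_Blinfun_apply[OF bounded_linear_choi_map])
  show "?\<Phi> \<in> channels"
    using assms choi_map_linear completely_positive_choi_map trace_preserving_choi_map
    by (auto simp: channels_def app choi_matrices_def)
  show "choi ?\<Phi> = C"
    by (simp add: vec_eq_iff choi_nth app choi_map_def)
      (simp add: ketbra_def ket_def axis_def if_distrib[of cnj] if_distrib[of "\<lambda>x. x * _"]
        if_distrib[of "\<lambda>x. _ * x"] cong: if_cong)
qed

lemma choi_image_channels: "choi ` channels = choi_matrices"
  using choi_in_choi_matrices choi_map_channel by (auto simp: image_iff)

section \<open>Sharp measurements and outcome probabilities\<close>

text \<open>Orthonormality says that \<open>U\<close> has a right inverse. For a square matrix this
  is also a left inverse, and that second product is the resolution of the identity; spanning thus
  comes for free.\<close>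

lemma orthonormal_unitary:
  fixes e :: "'n::finite \<Rightarrow> complex^'n"
  assumes "\<And>i j. cinner (e i) (e j) = of_bool (i = j)"
  defines "U \<equiv> \<chi> i j. cnj (e i $ j)"
  shows "unitary U" and "U *v e i = ket i" and "cadjoint U *v v = (\<Sum>i\<in>UNIV. v $ i *s e i)"
    and "cadjoint U ** U = (\<Sum>i\<in>UNIV. proj (e i))"
proof -
  have "U ** cadjoint U = mat 1"
    using assms(1) by (simp add: U_def vec_eq_iff cadjoint_def matrix_matrix_mult_def mat_def cinner_def)
  then show "unitary U"
    using matrix_left_right_inverse[of U "cadjoint U"] by (simp add: unitary_def)
  show "U *v e i = ket i"
    using assms(1)[of _ i] by (simp add: U_def vec_eq_iff matrix_vector_mult_def cinner_def ket_def axis_def)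
  show "cadjoint U *v v = (\<Sum>i\<in>UNIV. v $ i *s e i)"
    by (simp add: U_def vec_eq_iff matrix_vector_mult_def cadjoint_def mult.commute sum_component)
  show "cadjoint U ** U = (\<Sum>i\<in>UNIV. proj (e i))"
    by (simp add: U_def vec_eq_iff matrix_matrix_mult_def cadjoint_def ketbra_def sum_component)
qed

lemma orthonormal_basisI:
  fixes e :: "'n::finite \<Rightarrow> complex^'n"
  assumes "\<And>i j. cinner (e i) (e j) = of_bool (i = j)"
  shows "orthonormal_basis e"
proof -
  let ?U = "\<chi> i j. cnj (e i $ j)"
  have "v = (\<Sum>i\<in>UNIV. (?U *v v) $ i *s e i)" for v
    using orthonormal_unitary(1,3)[of e, OF assms]
    by (metis unitary_def matrix_vector_mul_assoc matrix_vector_mul_lid)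
  then show ?thesis using assms unfolding orthonormal_basis_def by blast
qed

lemma orthonormal_basisD:
  "orthonormal_basis e \<Longrightarrow> cinner (e i) (e j) = of_bool (i = j)"
  by (simp add: orthonormal_basis_def)

lemma orthonormal_basis_rotation:
  assumes "orthonormal_basis e"
  shows "\<exists>U. unitary U \<and> (\<forall>i. U *v e i = ket i)"
  using orthonormal_unitary(1,2)[of e, OF orthonormal_basisD[OF assms]] by blast

lemma sum_proj_orthonormal_basis:
  assumes "orthonormal_basis e"
  shows "(\<Sum>i\<in>UNIV. proj (e i)) = mat 1"
  using orthonormal_unitary(1,4)[of e, OF orthonormal_basisD[OF assms]] by (simp add: unitary_def)

lemma proj_orthonormal_basis_2:
  "orthonormal_basis e \<Longrightarrow> proj (e 0) + proj (e (1::2)) = mat 1"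
  using sum_proj_orthonormal_basis[of e] by (simp add: sum_UNIV_2)

lemma matrix_eq_sum_orthonormal_basis:
  fixes A :: "complex^'n^'n::finite"
  assumes "orthonormal_basis e"
  shows "A = (\<Sum>i\<in>UNIV. ketbra (A *v e i) (e i))"
proof -
  have "A = A ** (\<Sum>i\<in>UNIV. proj (e i))"
    using sum_proj_orthonormal_basis[OF assms] by simp
  then show ?thesis by (simp add: matrix_mult_sum mult_ketbra)
qed

lemma matrix_eq_on_orthonormal_basis:
  fixes A B :: "complex^'n^'n::finite"
  assumes e: "orthonormal_basis e" and eq: "\<And>p q. cinner (e p) (A *v e q) = cinner (e p) (B *v e q)"
  shows "A = B"
proof -
  have "A *v e q = B *v e q" for q
  proof -
    define d where "d = A *v e q - B *v e q"
    obtain c where c: "d = (\<Sum>i\<in>UNIV. c i *s e i)"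
      using e unfolding orthonormal_basis_def by blast
    have "cinner (e p) d = 0" for p
      using eq[of p q] by (simp add: d_def cinner_diff_right)
    then have "cinner d d = 0"
      by (subst (1) c) (simp add: cinner_sum_left cinner_scale_left)
    then show ?thesis by (simp add: d_def)
  qed
  then show ?thesis
    using matrix_eq_sum_orthonormal_basis[OF e, of A] matrix_eq_sum_orthonormal_basis[OF e, of B] by simp
qed

lemma unitary_cinner:
  "unitary U \<Longrightarrow> cinner (U *v v) (U *v w) = cinner v w"
  by (subst cinner_mult_right) (simp add: matrix_vector_mul_assoc unitary_def)

lemma unitary_orthonormal_basis:
  "unitary U \<Longrightarrow> orthonormal_basis e \<Longrightarrow> orthonormal_basis (\<lambda>i. U *v e i)"
  by (intro orthonormal_basisI) (simp add: unitary_cinner orthonormal_basisD)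

lemma orthonormal_basis_ket: "orthonormal_basis ket"
  by (intro orthonormal_basisI) (simp, auto simp: ket_def axis_def)

lemma orthonormal_basis_pair:
  fixes u v :: "complex^2"
  assumes "cinner u u = 1" "cinner v v = 1" "cinner u v = 0"
  shows "orthonormal_basis (\<lambda>i. if i = 0 then u else v)"
proof (rule orthonormal_basisI)
  have "cinner v u = 0" using cinner_commute[of v u] assms(3) by simp
  then show "cinner (if i = 0 then u else v) (if j = 0 then u else v) = of_bool (i = j)" for i j :: 2
    using assms by (auto simp: neq_iff_2)
qed

lemma unit_orthogonal_2:
  fixes u :: "complex^2"
  assumes "cinner u u = 1"
  shows "\<exists>v. cinner v v = 1 \<and> cinner u v = 0"
proof
  let ?v = "\<chi> j::2. if j = 0 then - cnj (u $ 1) else cnj (u $ 0)"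
  show "cinner ?v ?v = 1 \<and> cinner u ?v = 0"
    using assms unfolding cinner_def sum_UNIV_2 by (simp add: mult.commute add.commute)
qed

lemma invertible_or_unit_kernel:
  fixes A :: "complex^'n^'n::finite"
  shows "(\<exists>B. A ** B = mat 1) \<or> (\<exists>u. cinner u u = 1 \<and> A *v u = 0)"
proof (cases "\<exists>x. x \<noteq> 0 \<and> A *v x = 0")
  case True
  then obtain x where x: "x \<noteq> 0" "A *v x = 0" by blast
  obtain r where r: "cinner x x = of_real r" "0 \<le> r"
    using cinner_self_real[of x] by (metis sum_nonneg zero_le_power2)
  then have "r > 0" using x by (metis cinner_self_eq_0 less_eq_real_def of_real_0)
  let ?c = "complex_of_real (1 / sqrt r)"
  have "complex_of_real (sqrt r) * complex_of_real (sqrt r) = of_real r"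
    using \<open>r > 0\<close> by (simp flip: of_real_mult)
  then have "cinner (?c *s x) (?c *s x) = 1"
    using \<open>r > 0\<close> by (simp add: cinner_scale_left cinner_scale_right r field_simps)
  moreover have "A *v (?c *s x) = 0" using x(2) by (simp add: matrix_scale_vec)
  ultimately show ?thesis by blast
next
  case False
  then obtain B where "B ** A = mat 1"
    using matrix_left_invertible_ker[of A] by blast
  then show ?thesis using matrix_left_right_inverse by blast
qed

text \<open>The map sending \<open>x\<close> to \<open>kron_vec x s\<close>, as a rectangular
  matrix. Conjugating by it tensors with \<open>proj s\<close>; its adjoint compresses back.\<close>

definition tensor_isometry :: "complex^'n \<Rightarrow> complex^'m^('m \<times> 'n::finite)" where
  "tensor_isometry s = (\<chi> p b. of_bool (fst p = b) * s $ snd p)"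

lemma tensor_isometry_conjugate:
  fixes M :: "complex^'m^'m::finite" and s :: "complex^'n::finite"
  shows "tensor_isometry s ** M ** cadjoint (tensor_isometry s) = kron M (proj s)"
  by (simp add: vec_eq_iff tensor_isometry_def matrix_matrix_mult_def cadjoint_def kron_def ketbra_def
      if_distrib[of cnj] if_distrib[of "\<lambda>x. x * _"] if_distrib[of "\<lambda>x. _ * x"] of_bool_def mult_ac cong: if_cong)

lemma cadjoint_tensor_isometry:
  fixes s :: "complex^'n::finite"
  assumes "cinner s s = 1"
  shows "cadjoint (tensor_isometry s) ** tensor_isometry s = (mat 1 :: complex^'m^'m::finite)"
proof -
  have "(\<Sum>a\<in>UNIV. \<Sum>n\<in>UNIV. cnj (of_bool (a = i) * s $ n) * (of_bool (a = j) * s $ n)) =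
      (mat 1 :: complex^'m^'m) $ i $ j" for i j :: 'm
  proof -
    have "(\<Sum>n\<in>UNIV. cnj (of_bool (a = i) * s $ n) * (of_bool (a = j) * s $ n)) =
        of_bool (a = i) * of_bool (a = j)" for a
      using assms by (simp add: cinner_def)
    then show ?thesis
      by (auto simp: mat_def of_bool_def if_distrib[of "\<lambda>x. x * _"] if_distrib[of "\<lambda>x. _ * x"] cong: if_cong)
  qed
  then show ?thesis
    by (simp add: vec_eq_iff tensor_isometry_def matrix_matrix_mult_def cadjoint_def sum_UNIV_prod)
qed

lemma psd_congruence: "psd A \<Longrightarrow> psd (cadjoint J ** A ** J)"
  for A :: "complex^'n^'n::finite" and J :: "complex^'m::finite^'n"
  using cinner_mult_right[of _ "cadjoint J"]
  by (simp add: psd_def matrix_vector_mul_assoc[symmetric])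

text \<open>Taking adjoints turns support on the right into support on both sides, so
  \<open>A\<close> is unchanged when sandwiched between projections \<open>J ** cadjoint J\<close>.
  The factor \<open>M\<close> is the compression of \<open>A\<close> by the isometry
  \<open>J\<close>.\<close>

lemma psd_supported_on_proj:
  fixes A :: "complex^('m::finite \<times> 'n::finite)^('m \<times> 'n)"
  assumes A: "psd A" "A ** kron (mat 1) (proj s) = A" and s: "cinner s s = 1"
  shows "\<exists>M. psd M \<and> A = kron M (proj s)"
proof -
  let ?J = "tensor_isometry s :: complex^'m^('m \<times> 'n)"
  have JJ: "?J ** cadjoint ?J = kron (mat 1) (proj s)"
    using tensor_isometry_conjugate[of s "mat 1"] by simp
  have "kron (mat 1) (proj s) ** A = A"
    using arg_cong[OF A(2), of cadjoint]
    by (simp add: cadjoint_mult psd_hermitian[OF A(1)] cadjoint_kron cadjoint_ketbra)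
  then have "A = (?J ** cadjoint ?J) ** A ** (?J ** cadjoint ?J)"
    using A(2) by (simp add: JJ)
  also have "\<dots> = ?J ** (cadjoint ?J ** A ** ?J) ** cadjoint ?J"
    by (simp add: matrix_mul_assoc)
  finally have "A = kron (cadjoint ?J ** A ** ?J) (proj s)"
    by (simp only: tensor_isometry_conjugate)
  then show ?thesis using psd_congruence[OF A(1)] by blast
qed

lemma kron_proj_inject:
  fixes M N :: "complex^'m^'m::finite" and s :: "complex^'n::finite"
  assumes "kron M (proj s) = kron N (proj s)" "cinner s s = 1"
  shows "M = N"
proof -
  let ?J = "tensor_isometry s :: complex^'m^('m \<times> 'n)"
  have "cadjoint ?J ** kron K (proj s) ** ?J = K" for K
  proof -
    have "cadjoint ?J ** kron K (proj s) ** ?J = (cadjoint ?J ** ?J) ** K ** (cadjoint ?J ** ?J)"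
      by (simp only: tensor_isometry_conjugate[symmetric] matrix_mul_assoc)
    then show ?thesis by (simp add: cadjoint_tensor_isometry[OF assms(2)])
  qed
  then show ?thesis using assms(1) by metis
qed

lemma choi_trace_kron_mat_1:
  "C \<in> choi_matrices \<Longrightarrow> trace (C ** kron (mat 1) \<sigma>) = trace \<sigma>"
  by (simp add: choi_matrices_def partial_trace_out_eq_iff)

text \<open>In the basis \<open>u\<close>, \<open>v\<close> the kernel vector and hermiticity remove
  all entries but one, and the trace sets that one to \<open>1\<close>.\<close>

lemma density_eq_proj:
  fixes \<sigma> :: "complex^2^2"
  assumes "density \<sigma>" "cinner u u = 1" "\<sigma> *v u = 0" "cinner v v = 1" "cinner u v = 0"
  shows "\<sigma> = proj v"
proof -
  let ?e = "\<lambda>i::2. if i = 0 then u else v"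
  have e: "orthonormal_basis ?e" using orthonormal_basis_pair assms by blast
  have "\<sigma> = ketbra (\<sigma> *v v) v"
    using matrix_eq_sum_orthonormal_basis[OF e, of \<sigma>] assms(3)
    by (simp add: sum_UNIV_2) (simp add: ketbra_def vec_eq_iff)
  then have \<sigma>: "cinner v (\<sigma> *v v) = 1"
    using assms(1) by (metis density_def trace_ketbra)
  have "cinner u (\<sigma> *v v) = 0"
    using psd_cinner_swap[of \<sigma> u v] assms(1,3) by (simp add: density_def)
  show ?thesis
  proof (rule matrix_eq_on_orthonormal_basis[OF e])
    fix p q :: 2
    have "cinner v u = 0" using cinner_commute[of v u] assms(5) by simp
    then show "cinner (?e p) (\<sigma> *v ?e q) = cinner (?e p) (proj v *v ?e q)"
      using \<sigma> \<open>cinner u (\<sigma> *v v) = 0\<close> assms by (simp add: ketbra_mult_vec cinner_scale_right)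
  qed
qed

lemma ppovm_sharp:
  fixes F Fp :: "complex^(2 \<times> 2)^(2 \<times> 2)"
  assumes F: "psd F" "psd Fp" "F + Fp = kron (mat 1) \<sigma>" and \<sigma>: "density \<sigma>"
    and D: "D \<noteq> 0" "D ** kron (mat 1) \<sigma> = 0"
    and C: "C \<in> choi_matrices" "C ** F = 0" and C': "C' \<in> choi_matrices" "C' ** Fp = 0"
  shows "\<exists>s a. cinner s s = 1 \<and> orthonormal_basis a \<and>
    F = kron (proj (a 0)) (proj s) \<and> Fp = kron (proj (a 1)) (proj s)"
proof -
  have "\<nexists>B. \<sigma> ** B = mat 1"
  proof
    assume "\<exists>B. \<sigma> ** B = mat 1"
    then obtain B where "\<sigma> ** B = mat 1" by blast
    then have "D = D ** kron (mat 1) \<sigma> ** kron (mat 1) B"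
      by (simp add: matrix_mul_assoc[symmetric] kron_mult kron_mat_1)
    then show False using D by simp
  qed
  then obtain u where u: "cinner u u = 1" "\<sigma> *v u = 0"
    using invertible_or_unit_kernel[of \<sigma>] by blast
  obtain s where s: "cinner s s = 1" "cinner u s = 0" using unit_orthogonal_2[OF u(1)] by blast
  have \<sigma>s: "\<sigma> = proj s" using density_eq_proj[OF \<sigma> u s] .
  let ?Q = "kron (mat 1) (proj u) :: complex^(2 \<times> 2)^(2 \<times> 2)"
  let ?P = "kron (mat 1) (proj s) :: complex^(2 \<times> 2)^(2 \<times> 2)"
  have Q: "psd ?Q" by (rule psd_kron_proj[OF psd_mat_1])
  have PQ: "?Q + ?P = mat 1"
    using proj_orthonormal_basis_2[OF orthonormal_basis_pair[OF u(1) s]]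
    by (simp add: kron_add_right[symmetric] kron_mat_1)
  \<comment> \<open>As \<sigma> kills \<open>u\<close>, the traces of \<open>F\<close> and
    \<open>Fp\<close> against \<open>?Q\<close> sum to zero. Both are nonnegative, so both operators
    vanish on \<open>?Q\<close> and live on \<open>?P\<close>.\<close>
  have "F ** ?Q + Fp ** ?Q = 0"
    using u(2) by (simp add: matrix_mult_add_left[symmetric] F(3) kron_mult mult_ketbra)
      (simp add: kron_def ketbra_def vec_eq_iff)
  then have tr: "trace (F ** ?Q) + trace (Fp ** ?Q) = 0"
    by (metis trace_add trace_0 mat_0)
  moreover note pos = trace_mult_psd_nonneg[OF F(1) Q] trace_mult_psd_nonneg[OF F(2) Q]
  ultimately have "Re (trace (F ** ?Q)) = 0" "Re (trace (Fp ** ?Q)) = 0"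
    by (auto simp: less_eq_complex_def complex_eq_iff)
  then have "F ** ?Q = 0" "Fp ** ?Q = 0"
    using trace_mult_psd_eq_0 F Q by blast+
  then have FP: "F ** ?P = F" "Fp ** ?P = Fp"
    using arg_cong[OF PQ, of "\<lambda>A. F ** A"] arg_cong[OF PQ, of "\<lambda>A. Fp ** A"]
    by (simp_all add: matrix_add_ldistrib)
  obtain A where A: "psd A" "F = kron A (proj s)"
    using psd_supported_on_proj[OF F(1) FP(1) s(1)] by blast
  obtain B where B: "psd B" "Fp = kron B (proj s)"
    using psd_supported_on_proj[OF F(2) FP(2) s(1)] by blast
  have AB: "A + B = mat 1"
  proof (rule kron_proj_inject[OF _ s(1)])
    show "kron (A + B) (proj s) = kron (mat 1) (proj s)"
      using F(3) by (simp add: A B \<sigma>s kron_add_left)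
  qed
  \<comment> \<open>Were \<open>M\<close> invertible, multiplying by its inverse on the output would
    give \<open>E ** ?P = 0\<close>, but this product has trace \<open>1\<close> for every Choi
    matrix \<open>E\<close>.\<close>
  have sing: "\<exists>x. cinner x x = 1 \<and> M *v x = 0"
    if "E \<in> choi_matrices" "E ** kron M (proj s) = 0" for E and M :: "complex^2^2"
  proof (rule ccontr)
    assume "\<nexists>x. cinner x x = 1 \<and> M *v x = 0"
    then obtain M' where "M ** M' = mat 1" using invertible_or_unit_kernel[of M] by blast
    then have "E ** ?P = E ** kron M (proj s) ** kron M' (mat 1)"
      by (simp add: matrix_mul_assoc[symmetric] kron_mult)
    then have "trace (E ** ?P) = 0" using that(2) by (simp add: trace_def)
    then show False using choi_trace_kron_mat_1[OF that(1), of "proj s"] s(1) by (simp add: trace_ketbra)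
  qed
  obtain x where x: "cinner x x = 1" "A *v x = 0" using sing[OF C(1)] C(2) A by blast
  obtain y where y: "cinner y y = 1" "B *v y = 0" using sing[OF C'(1)] C'(2) B by blast
  \<comment> \<open>A kernel vector of \<open>B = 1 - A\<close> is fixed by \<open>A\<close>; being
    orthogonal to the kernel vector \<open>x\<close>, it completes an eigenbasis with eigenvalues
    \<open>1\<close> and \<open>0\<close>.\<close>
  have Ay: "A *v y = y"
    using arg_cong[OF AB, of "\<lambda>M. M *v y"] y(2) by (simp add: matrix_vector_mult_add_rdistrib)
  have yx: "cinner y x = 0"
    using cinner_mult_right[of y A x] by (simp add: psd_hermitian[OF A(1)] Ay x(2))
  let ?a = "\<lambda>i::2. if i = 0 then y else x"
  have a: "orthonormal_basis ?a" using orthonormal_basis_pair[OF y(1) x(1) yx] .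
  have Aeq: "A = proj y"
    using matrix_eq_sum_orthonormal_basis[OF a, of A] Ay x(2)
    by (simp add: sum_UNIV_2) (simp add: ketbra_def vec_eq_iff)
  have "proj y + B = proj y + proj x"
    using AB proj_orthonormal_basis_2[OF a] by (simp add: Aeq)
  then have "B = proj x" by simp
  then show ?thesis
    using s(1) a A(2) B(2) Aeq by (intro exI[of _ s] exI[of _ ?a]) simp
qed

text \<open>The forms at \<open>b 0\<close> and \<open>b 1\<close> tensored with \<open>y\<close>
  are nonnegative and sum to \<open>cinner y y\<close> by trace preservation. The vector
  \<open>y\<close> need not be normalised, as required for the remainder of a projection.\<close>

lemma choi_quadratic_form_le:
  fixes C :: "complex^(2 \<times> 'n::finite)^(2 \<times> 'n)"
  assumes C: "C \<in> choi_matrices" and b: "orthonormal_basis b"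
  shows "Re (cinner (kron_vec (b i) y) (C *v kron_vec (b i) y)) \<le> Re (cinner y y)"
proof -
  have "kron (mat 1) (proj y) = kron (proj (b 0)) (proj y) + kron (proj (b 1)) (proj y)"
    by (simp only: kron_add_left[symmetric] proj_orthonormal_basis_2[OF b])
  then have sum: "trace (C ** kron (proj (b 0)) (proj y)) + trace (C ** kron (proj (b 1)) (proj y)) = cinner y y"
    using choi_trace_kron_mat_1[OF C, of "proj y"]
    by (simp only: matrix_add_ldistrib trace_add trace_ketbra)
  have "0 \<le> trace (C ** kron (proj (b j)) (proj y))" for j
    using C by (intro trace_mult_psd_nonneg psd_kron_proj psd_proj) (simp add: choi_matrices_def)
  from this[of 0] this[of 1] show ?thesis
    using arg_cong[OF sum, of Re] exhaust_2[of i]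
    by (auto simp: two_eq_0 trace_mult_proj[symmetric] proj_kron_vec less_eq_complex_def)
qed

section \<open>Outcome probabilities as effects on Choi matrices\<close>

definition prob :: "complex^('m::finite \<times> 'n::finite)^('m \<times> 'n) \<Rightarrow> complex^('m \<times> 'n)^('m \<times> 'n) \<Rightarrow> real" where
  "prob F C = Re (trace (C ** F))"

lemma outcome_prob_eq: "outcome_prob F = (\<lambda>\<Phi>. prob F (choi \<Phi>))"
  by (simp add: fun_eq_iff outcome_prob_def prob_def)

lemma prob_complement:
  assumes "F + Fp = kron (mat 1) \<sigma>" "density \<sigma>" "C \<in> choi_matrices"
  shows "prob F C + prob Fp C = 1"
proof -
  have "trace (C ** F) + trace (C ** Fp) = 1"
    using choi_trace_kron_mat_1[OF assms(3), of \<sigma>] assms(1,2)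
    by (simp add: density_def trace_add[symmetric] matrix_add_ldistrib[symmetric])
  from arg_cong[OF this, of Re] show ?thesis by (simp add: prob_def)
qed

lemma prob_nonneg: "psd F \<Longrightarrow> C \<in> choi_matrices \<Longrightarrow> 0 \<le> prob F C"
  using trace_mult_psd_nonneg[of C F] by (simp add: prob_def choi_matrices_def less_eq_complex_def)

lemma prob_eq_0: "psd F \<Longrightarrow> C \<in> choi_matrices \<Longrightarrow> prob F C = 0 \<Longrightarrow> C ** F = 0"
  using trace_mult_psd_eq_0[of C F] by (simp add: prob_def choi_matrices_def)

lemma prob_add: "prob F (C + D) = prob F C + prob F D"
  and prob_diff: "prob F (C - D) = prob F C - prob F D"
  and prob_scale: "prob F (r *\<^sub>R C) = r * prob F C"
  by (simp_all add: prob_def trace_def matrix_matrix_mult_def algebra_simps sum.distrib sum_subtractf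
      sum_distrib_left scaleR_conv_of_real[where 'a = complex])

lemma prob_effect:
  assumes "ppovm F Fp"
  shows "prob F \<in> effects choi_matrices"
proof (rule effectsI)
  fix C :: "complex^('a \<times> 'b)^('a \<times> 'b)" assume C: "C \<in> choi_matrices"
  obtain \<sigma> where F: "psd F" "psd Fp" "density \<sigma>" "F + Fp = kron (mat 1) \<sigma>"
    using assms by (auto simp: ppovm_def)
  show "0 \<le> prob F C" using prob_nonneg[OF F(1) C] .
  show "prob F C \<le> 1"
    using prob_complement[OF F(4,3) C] prob_nonneg[OF F(2) C] by simp
qed (simp add: prob_add prob_scale)

lemma continuous_on_prob: "continuous_on S (prob F)"
  unfolding prob_def trace_def matrix_matrix_mult_def
  by (simp, intro continuous_intros)

lemma maximally_incompatible_iff_choi_witness: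
  fixes F F_perp F' F'_perp :: "complex^('m::finite \<times> 'n::finite)^('m \<times> 'n)"
  assumes "ppovm F F_perp" "ppovm F' F'_perp"
  shows "maximally_incompatible channels (outcome_prob F) (outcome_prob F') \<longleftrightarrow>
    (\<exists>C. witness_square choi_matrices (prob F) (prob F') C)"
proof -
  have "maximally_incompatible channels (outcome_prob F) (outcome_prob F') \<longleftrightarrow>
      maximally_incompatible choi_matrices (prob F) (prob F')"
    unfolding outcome_prob_eq choi_image_channels[symmetric]
    by (rule maximally_incompatible_linear_image[OF linear_choi inj_on_choi convex_channels, symmetric])
  then show ?thesis
    using maximally_incompatible_iff_witness_square[OF compact_choi_matrices convex_choi_matrices
        choi_matrices_nonempty prob_effect[OF assms(1)] prob_effect[OF assms(2)]
        continuous_on_prob continuous_on_prob] by simp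
qed

lemma choi_witness_square:
  "witness_square channels (outcome_prob F) (outcome_prob F') x \<Longrightarrow>
    witness_square choi_matrices (prob F) (prob F') (\<lambda>i j. choi (x i j))"
  using witness_square_linear_image[OF linear_choi inj_on_choi convex_channels, of x "prob F" "prob F'"]
  by (simp add: outcome_prob_eq choi_image_channels) (simp add: witness_square_def)

lemma choi_witness_square_lift:
  assumes "witness_square choi_matrices (prob F) (prob F') C"
  shows "\<exists>x. witness_square channels (outcome_prob F) (outcome_prob F') x"
proof -
  have "\<forall>i j. \<exists>\<Phi>\<in>channels. choi \<Phi> = C i j"
    using assms by (auto simp: witness_square_def intro!: choi_map_channel)
  then obtain x where x: "\<And>i j. x i j \<in> channels" "\<And>i j. choi (x i j) = C i j"
    by metis
  then show ?thesis
    using witness_square_linear_image[OF linear_choi inj_on_choi convex_channels, of x "prob F" "prob F'"] assms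
    by (auto simp: outcome_prob_eq choi_image_channels)
qed

section \<open>Witness squares for qubit channels\<close>

lemma witness_square_choiD:
  assumes "witness_square choi_matrices (prob F) (prob F') C"
  shows "C i j \<in> choi_matrices" and "prob F (C i j) = of_bool (i = 1)" and "prob F' (C i j) = of_bool (j = 1)"
    and "C 1 1 - C 1 0 = C 0 1 - C 0 0" and "C 1 1 - C 0 1 = C 1 0 - C 0 0"
proof -
  have "C 0 0 + C 1 1 = C 1 0 + C 0 1"
    using assms by (simp add: witness_square_def)
  then show "C 1 1 - C 1 0 = C 0 1 - C 0 0" "C 1 1 - C 0 1 = C 1 0 - C 0 0"
    by (simp_all add: algebra_simps)
qed (use assms in \<open>auto simp: witness_square_def\<close>)

lemma prob_eq_1:
  assumes "psd Fp" "F + Fp = kron (mat 1) \<sigma>" "density \<sigma>" "C \<in> choi_matrices" "prob F C = 1"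
  shows "C ** Fp = 0"
  using prob_eq_0[OF assms(1,4)] prob_complement[OF assms(2,3,4)] assms(5) by simp

text \<open>The second measurement enters only by certifying that the difference is nonzero. The
  annihilation property is kept in the conclusion for the comparison of the two inputs.\<close>

lemma witness_square_sharp:
  fixes F Fp F' :: "complex^(2 \<times> 2)^(2 \<times> 2)"
  assumes F: "ppovm F Fp" and w: "witness_square choi_matrices (prob F) (prob F') C"
  shows "\<exists>s a. cinner s s = 1 \<and> orthonormal_basis a \<and>
    F = kron (proj (a 0)) (proj s) \<and> Fp = kron (proj (a 1)) (proj s) \<and>
    (C 1 1 - C 1 0) ** kron (mat 1) (proj s) = 0"
proof -
  note C = witness_square_choiD[OF w]
  obtain \<sigma> where \<sigma>: "psd F" "psd Fp" "density \<sigma>" "F + Fp = kron (mat 1) \<sigma>"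
    using F by (auto simp: ppovm_def)
  have kill: "C 0 j ** F = 0" "C 1 j ** Fp = 0" for j
    using prob_eq_0[OF \<sigma>(1) C(1)] prob_eq_1[OF \<sigma>(2,4,3) C(1)] C(2)[of 0 j] C(2)[of 1 j] by simp_all
  let ?D = "C 1 1 - C 1 0"
  have "?D ** F = 0"
    unfolding C(4) by (simp add: matrix_mult_diff_left kill)
  moreover have "?D ** Fp = 0"
    by (simp add: matrix_mult_diff_left kill)
  ultimately have D\<sigma>: "?D ** kron (mat 1) \<sigma> = 0"
    by (simp add: \<sigma>(4)[symmetric] matrix_add_ldistrib)
  have "prob F' ?D = 1" by (simp add: prob_diff C(3))
  then have "?D \<noteq> 0" by (auto simp: prob_def trace_def)
  from ppovm_sharp[OF \<sigma>(1,2,4,3) this D\<sigma> C(1) kill(1) C(1) kill(2)]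
  obtain s a where s: "cinner s s = 1" "orthonormal_basis a"
    "F = kron (proj (a 0)) (proj s)" "Fp = kron (proj (a 1)) (proj s)" by blast
  have "F + Fp = kron (mat 1) (proj s)"
    by (simp only: s(3,4) kron_add_left[symmetric] proj_orthonormal_basis_2[OF s(2)])
  then have "kron (mat 1) \<sigma> = (kron (mat 1) (proj s) :: complex^(2 \<times> 2)^(2 \<times> 2))"
    by (simp add: \<sigma>(4))
  then show ?thesis using s D\<sigma> by (intro exI[of _ s] exI[of _ a]) simp
qed

lemma witness_square_transpose:
  "witness_square K f f' x \<Longrightarrow> witness_square K f' f (\<lambda>i j. x j i)"
  by (auto simp: witness_square_def add.commute)

text \<open>The two inputs are orthogonal: \<open>D\<close> does not see the component of \<open>s'\<close> along \<open>s\<close>, so the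
  remaining component \<open>y\<close> must carry the whole probability \<open>1\<close>, which is bounded by \<open>cinner y y\<close>.\<close>

lemma witness_square_inputs_orthogonal:
  fixes F Fp F' :: "complex^(2 \<times> 2)^(2 \<times> 2)"
  assumes w: "witness_square choi_matrices (prob F) (prob F') C"
    and s: "cinner s s = 1" "(C 1 1 - C 1 0) ** kron (mat 1) (proj s) = 0"
    and s': "cinner s' s' = 1" and b: "orthonormal_basis b" "F' = kron (proj (b 0)) (proj s')"
  shows "cinner s s' = 0"
proof -
  note C = witness_square_choiD[OF w]
  define D where "D = C 1 1 - C 1 0"
  define c where "c = cinner s s'"
  define y where "y = s' - c *s s"
  define u where "u = kron_vec (b 0) y"
  define z where "z = kron_vec (b 0) s"
  have psd: "psd (C i j)" for i j using C(1) by (simp add: choi_matrices_def)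
  have "D *v z = D ** kron (mat 1) (proj s) *v z"
    by (simp add: z_def matrix_vector_mul_assoc[symmetric] kron_mult_vec ketbra_mult_vec s(1))
  then have Dz: "D *v z = 0" using s(2) by (simp add: D_def)
  have "cadjoint D = D" using psd_hermitian[OF psd] by (simp add: D_def cadjoint_diff)
  then have zD: "cinner z (D *v x) = 0" for x
    using cinner_mult_right[of z D x] Dz by simp
  have dec: "kron_vec (b 0) s' = u + c *s z"
    by (simp add: u_def z_def y_def kron_vec_diff_right kron_vec_scale_right)
  have "cinner (kron_vec (b 0) s') (D *v kron_vec (b 0) s') = cinner u (D *v u)"
    unfolding dec quadratic_form_add Dz zD by simp
  moreover have "prob F' D = 1" by (simp add: D_def prob_diff C(3))
  ultimately have "Re (cinner u (D *v u)) = 1"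
    by (simp add: b(2) prob_def proj_kron_vec[symmetric] trace_mult_proj)
  moreover have "Re (cinner u (D *v u)) = Re (cinner u (C 1 1 *v u)) - Re (cinner u (C 1 0 *v u))"
    by (simp add: D_def matrix_vector_mult_diff_rdistrib cinner_diff_right)
  moreover have "0 \<le> Re (cinner u (C 1 0 *v u))"
    using psdD[OF psd] by (simp add: less_eq_complex_def)
  moreover have "Re (cinner u (C 1 1 *v u)) \<le> Re (cinner y y)"
    unfolding u_def by (rule choi_quadratic_form_le[OF C(1) b(1)])
  moreover have "cinner y y = 1 - c * cnj c"
    using cinner_commute[of s' s] s(1) s'
    by (simp add: y_def cinner_diff_left cinner_diff_right cinner_scale_left cinner_scale_right c_def[symmetric] algebra_simps)
  \<comment> \<open>The chain reads \<open>1 \<le> cinner y y\<close>, and the right side is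
    \<open>1\<close> minus the squared modulus of \<open>c\<close>.\<close>
  ultimately have "(cmod c)\<^sup>2 \<le> 0"
    by (simp add: complex_mult_cnj cmod_power2)
  then show ?thesis by (simp add: c_def)
qed

lemma witness_square_imp_normal_form:
  assumes "ppovm F F_perp" "ppovm F' F'_perp"
    and w: "witness_square choi_matrices (prob F) (prob F') C"
  shows "\<exists>U_out U_in \<eta>. normal_form U_out U_in \<eta> F F_perp F' F'_perp"
proof -
  obtain s a where s: "cinner s s = 1" "(C 1 1 - C 1 0) ** kron (mat 1) (proj s) = 0"
    and a: "orthonormal_basis a" "F = kron (proj (a 0)) (proj s)" "F_perp = kron (proj (a 1)) (proj s)"
    using witness_square_sharp[OF assms(1) w] by blast
  \<comment> \<open>Transposing the square exchanges the roles of the two measurements.\<close>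
  obtain s' b where s': "cinner s' s' = 1"
    and b: "orthonormal_basis b" "F' = kron (proj (b 0)) (proj s')" "F'_perp = kron (proj (b 1)) (proj s')"
    using witness_square_sharp[OF assms(2) witness_square_transpose[OF w]] by blast
  have "cinner s s' = 0"
    using witness_square_inputs_orthogonal[OF w s s' b(1,2)] .
  from orthonormal_basis_rotation[OF orthonormal_basis_pair[OF s(1) s' this]]
  obtain V where V: "unitary V" "V *v s = ket 0" "V *v s' = ket 1"
    by (auto simp: all_2)
  obtain U where U: "unitary U" "\<And>i. U *v a i = ket i"
    using orthonormal_basis_rotation[OF a(1)] by blast
  \<comment> \<open>The input rotation straightens both pure inputs, but the output rotation is used
    up on the basis \<open>a\<close>. The basis \<open>b\<close> can only be carried along, which is
    why \<eta> remains free.\<close>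
  have "normal_form U V (\<lambda>i. U *v b i) F F_perp F' F'_perp"
    unfolding normal_form_def a b conjugate_by_kron conjugate_by_proj U(2) V proj_kron_vec
    using U(1) V(1) unitary_orthonormal_basis[OF U(1) b(1)] by simp
  then show ?thesis by blast
qed

text \<open>For \<open>s = ket\<close> this is the channel that measures the input and prepares one
  of two states accordingly. Outcome \<open>1\<close> belongs to index \<open>0\<close> of the
  bases, hence the shift by one.\<close>

definition square_choi :: "(2 \<Rightarrow> complex^'m) \<Rightarrow> (2 \<Rightarrow> complex^'m) \<Rightarrow> (2 \<Rightarrow> complex^'n) \<Rightarrow>
    2 \<Rightarrow> 2 \<Rightarrow> complex^('m::finite \<times> 'n::finite)^('m \<times> 'n)" where
  "square_choi a b s i j = kron (proj (a (i + 1))) (proj (s 0)) + kron (proj (b (j + 1))) (proj (s 1))"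

lemma two_cases: obtains "i = 0" | "i = (1::2)"
  using exhaust_2[of i] by (auto simp: two_eq_0)

lemma square_choi_witness:
  fixes a b s :: "2 \<Rightarrow> complex^2"
  assumes a: "orthonormal_basis a" and b: "orthonormal_basis b" and s: "orthonormal_basis s"
  shows "witness_square choi_matrices (prob (kron (proj (a 0)) (proj (s 0))))
    (prob (kron (proj (b 0)) (proj (s 1)))) (square_choi a b s)"
proof -
  have "square_choi a b s i j \<in> choi_matrices" for i j
  proof -
    have "trace (square_choi a b s i j ** kron (mat 1) \<sigma>) = trace \<sigma>" for \<sigma>
    proof -
      have "trace (square_choi a b s i j ** kron (mat 1) \<sigma>) =
          cinner (s 0) (\<sigma> *v s 0) + cinner (s 1) (\<sigma> *v s 1)"
        by (subst trace_mul_sym)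
          (simp add: square_choi_def matrix_add_ldistrib trace_add proj_kron_vec[symmetric] trace_mult_proj
            kron_mult_vec cinner_kron_vec orthonormal_basisD[OF a] orthonormal_basisD[OF b])
      also have "\<dots> = trace (\<sigma> ** (proj (s 0) + proj (s 1)))"
        by (simp add: matrix_add_ldistrib trace_add trace_mult_proj)
      finally show ?thesis by (simp add: proj_orthonormal_basis_2[OF s])
    qed
    then show ?thesis
      by (simp add: choi_matrices_def partial_trace_out_eq_iff square_choi_def psd_add psd_kron_proj psd_proj)
  qed
  moreover have pr: "prob (kron (proj v) (proj w)) (kron (proj v') (proj w')) =
      Re (cinner v v' * cinner w w' * (cinner v' v * cinner w' w))" for v v' w w' :: "complex^2"
    by (simp add: prob_def proj_kron_vec[symmetric] trace_mult_proj ketbra_mult_vec cinner_scale_right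
        cinner_kron_vec mult_ac)
  ultimately show ?thesis
    by (simp add: witness_square_def all_2 two_eq_0 square_choi_def prob_add pr orthonormal_basisD[OF a]
        orthonormal_basisD[OF b] orthonormal_basisD[OF s] algebra_simps)
qed

text \<open>In the orthonormal basis \<open>a k \<otimes> s 0\<close>, \<open>b k \<otimes> s 1\<close> the outcome probabilities determine everything
  but one off-diagonal entry of each matrix, and the parallelogram identity removes it.\<close>

lemma witness_square_unique:
  fixes a b s :: "2 \<Rightarrow> complex^2"
  assumes a: "orthonormal_basis a" and b: "orthonormal_basis b" and s: "orthonormal_basis s"
    and w: "witness_square choi_matrices (prob (kron (proj (a 0)) (proj (s 0))))
      (prob (kron (proj (b 0)) (proj (s 1)))) C"
  shows "C i j = square_choi a b s i j"
proof -
  note C = witness_square_choiD[OF w]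
  have psd: "psd (C i j)" for i j using C(1) by (simp add: choi_matrices_def)
  define x where "x k = kron_vec (a k) (s 0)" for k
  define y where "y k = kron_vec (b k) (s 1)" for k
  have xy: "cinner (x k) (x l) = of_bool (k = l)" "cinner (y k) (y l) = of_bool (k = l)"
    "cinner (x k) (y l) = 0" "cinner (y k) (x l) = 0" for k l
    by (simp_all add: x_def y_def cinner_kron_vec orthonormal_basisD[OF a] orthonormal_basisD[OF b]
        orthonormal_basisD[OF s])
  define e where "e p = (if snd p = 0 then x (fst p) else y (fst p))" for p :: "2 \<times> 2"
  have e: "orthonormal_basis e"
  proof (rule orthonormal_basisI)
    fix p q :: "2 \<times> 2"
    show "cinner (e p) (e q) = of_bool (p = q)"
      by (rule two_cases[of "snd p"]; rule two_cases[of "snd q"]) (auto simp: e_def xy prod_eq_iff)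
  qed
  \<comment> \<open>For a fixed pure input \<open>t\<close> the two output weights sum to
    \<open>1\<close>, and the probability decides which is zero; positivity then turns the zero
    weight into a kernel vector.\<close>
  have one: "cinner (kron_vec (d (k + 1)) t) (E *v kron_vec (d (k + 1)) t) = 1 \<and> E *v kron_vec (d k) t = 0"
    if E: "E \<in> choi_matrices" and d: "orthonormal_basis d" and t: "cinner t t = 1"
      and p: "prob (kron (proj (d 0)) (proj t)) E = of_bool (k = 1)"
    for E :: "complex^(2 \<times> 2)^(2 \<times> 2)" and d :: "2 \<Rightarrow> complex^2" and t k
  proof -
    have "psd E" using E by (simp add: choi_matrices_def)
    have q: "trace (E ** kron (proj (d l)) (proj t)) = cinner (kron_vec (d l) t) (E *v kron_vec (d l) t)" for l
      by (simp add: proj_kron_vec[symmetric] trace_mult_proj)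
    have "kron (mat 1) (proj t) = kron (proj (d 0)) (proj t) + kron (proj (d 1)) (proj t)"
      by (simp only: kron_add_left[symmetric] proj_orthonormal_basis_2[OF d])
    then have sum: "cinner (kron_vec (d 0) t) (E *v kron_vec (d 0) t) +
        cinner (kron_vec (d 1) t) (E *v kron_vec (d 1) t) = 1"
      using choi_trace_kron_mat_1[OF E, of "proj t"] t
      by (simp only: matrix_add_ldistrib trace_add trace_ketbra q)
    have "Im (cinner (kron_vec (d 0) t) (E *v kron_vec (d 0) t)) = 0"
      using psdD[OF \<open>psd E\<close>] by (simp add: less_eq_complex_def)
    then have 0: "cinner (kron_vec (d 0) t) (E *v kron_vec (d 0) t) = of_bool (k = 1)"
      using p by (simp add: prob_def q complex_eq_iff)
    have 1: "cinner (kron_vec (d 1) t) (E *v kron_vec (d 1) t) = 1 - of_bool (k = 1)"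
      using sum unfolding 0 by (metis add_diff_cancel_left')
    show ?thesis
      by (rule two_cases[of k]) (use 0 1 psd_kernel[OF \<open>psd E\<close>] in \<open>auto simp: two_eq_0\<close>)
  qed
  have x1: "cinner (x (i + 1)) (C i j *v x (i + 1)) = 1" and x0: "C i j *v x i = 0" for i j
    using one[OF C(1) a _ C(2)] by (simp_all add: x_def orthonormal_basisD[OF s])
  have y1: "cinner (y (j + 1)) (C i j *v y (j + 1)) = 1" and y0: "C i j *v y j = 0" for i j
    using one[OF C(1) b _ C(3)] by (simp_all add: y_def orthonormal_basisD[OF s])
  have x0': "cinner (x i) (C i j *v v) = 0" and y0': "cinner (y j) (C i j *v v) = 0" for i j v
    using psd_cinner_swap[OF psd, where x = v] x0 y0 by simp_all
  have par: "cinner v (C 1 1 *v u) - cinner v (C 1 0 *v u) = cinner v (C 0 1 *v u) - cinner v (C 0 0 *v u)" for u v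
    using arg_cong[OF C(4), of "\<lambda>M. cinner v (M *v u)"]
    by (simp add: matrix_vector_mult_diff_rdistrib cinner_diff_right)
  \<comment> \<open>At this entry the other three matrices vanish: each differs from
    \<open>C i j\<close> in an index and so has \<open>x (i + 1)\<close> or \<open>y (j + 1)\<close>
    in its kernel. The parallelogram identity therefore removes the fourth value too.\<close>
  have xy0: "cinner (x (i + 1)) (C i j *v y (j + 1)) = 0" for i j
    by (rule two_cases[of i]; rule two_cases[of j])
      (use par[of "x 0" "y 0"] par[of "x 0" "y 1"] par[of "x 1" "y 0"] par[of "x 1" "y 1"]
        in \<open>simp_all add: two_eq_0 x0' y0\<close>)
  have yx0: "cinner (y (j + 1)) (C i j *v x (i + 1)) = 0" for i j
    using psd_cinner_swap[OF psd, of "y (j + 1)" i j "x (i + 1)"] xy0[of i j] by simp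
  have R: "square_choi a b s i j = proj (x (i + 1)) + proj (y (j + 1))"
    by (simp add: square_choi_def x_def y_def proj_kron_vec)
  have Rv: "cinner v (square_choi a b s i j *v u) =
      cinner v (x (i + 1)) * cinner (x (i + 1)) u + cinner v (y (j + 1)) * cinner (y (j + 1)) u" for u v
    by (simp add: R matrix_vector_mult_add_rdistrib ketbra_mult_vec cinner_add_right cinner_scale_right mult.commute)
  have cases: "P k" if "P m" "P (m + 1)" for P :: "2 \<Rightarrow> bool" and m k
    using that neq_iff_2[of k m] by metis
  have "cinner (x k) (C i j *v x l) = of_bool (k = i + 1 \<and> l = i + 1)" for k l
    by (rule cases[of _ i k]; rule cases[of _ i l]) (simp_all add: x0 x0' x1)
  moreover have "cinner (y k) (C i j *v y l) = of_bool (k = j + 1 \<and> l = j + 1)" for k l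
    by (rule cases[of _ j k]; rule cases[of _ j l]) (simp_all add: y0 y0' y1)
  moreover have "cinner (x k) (C i j *v y l) = 0" "cinner (y l) (C i j *v x k) = 0" for k l
    by (rule cases[of _ i k]; rule cases[of _ j l]; simp add: x0 y0 x0' y0' xy0 yx0)+
  ultimately show ?thesis
    by (intro matrix_eq_on_orthonormal_basis[OF e]) (auto simp add: Rv e_def xy)
qed

section \<open>Moving witness squares to and from the normal form\<close>

lemma prob_conjugate_by:
  "unitary U \<Longrightarrow> prob (conjugate_by U F) (conjugate_by U C) = prob F C"
  by (simp add: prob_def conjugate_by_mult trace_conjugate_by)

lemma conjugate_by_scale: "conjugate_by U (r *\<^sub>R A) = r *\<^sub>R conjugate_by U A"
  by (simp add: conjugate_by_def vec_eq_iff matrix_matrix_mult_def scaleR_sum_right[symmetric])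

lemma witness_square_conjugate_by:
  assumes U: "unitary U" "unitary V" and w: "witness_square choi_matrices (prob F) (prob F') C"
  defines "W \<equiv> kron U V"
  shows "witness_square choi_matrices (prob (conjugate_by W F)) (prob (conjugate_by W F'))
    (\<lambda>i j. conjugate_by W (C i j))"
proof -
  have W: "unitary W" unfolding W_def by (rule unitary_kron[OF U])
  have "(1 / 2) *\<^sub>R (C 0 0 + C 1 1) = (1 / 2) *\<^sub>R (C 1 0 + C 0 1)"
    using w by (simp add: witness_square_def)
  from arg_cong[OF this, of "conjugate_by W"]
  have "(1 / 2) *\<^sub>R (conjugate_by W (C 0 0) + conjugate_by W (C 1 1)) =
      (1 / 2) *\<^sub>R (conjugate_by W (C 1 0) + conjugate_by W (C 0 1))"
    by (simp only: conjugate_by_scale conjugate_by_add)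
  then show ?thesis
    using w conjugate_by_choi_matrices[OF U]
    by (simp add: witness_square_def prob_conjugate_by[OF W, unfolded W_def] W_def)
qed

lemma normal_form_witness_eq:
  assumes nf: "normal_form U_out U_in \<eta> F F_perp F' F'_perp"
    and w: "witness_square choi_matrices (prob F) (prob F') C"
  shows "conjugate_by (kron U_out U_in) (C i j) = square_choi ket \<eta> ket i j"
proof (rule witness_square_unique)
  show "orthonormal_basis \<eta>" using nf by (simp add: normal_form_def)
  show "witness_square choi_matrices (prob (kron (proj (ket 0)) (proj (ket 0))))
      (prob (kron (proj (\<eta> 0)) (proj (ket 1)))) (\<lambda>i j. conjugate_by (kron U_out U_in) (C i j))"
    using witness_square_conjugate_by[OF _ _ w, of U_out U_in] nf
    by (simp add: normal_form_def proj_kron_vec)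
qed (rule orthonormal_basis_ket)+

lemma normal_form_imp_witness:
  assumes nf: "normal_form U_out U_in \<eta> F F_perp F' F'_perp"
  shows "\<exists>C. witness_square choi_matrices (prob F) (prob F') C"
proof -
  let ?W = "kron U_out U_in"
  have U: "unitary U_out" "unitary U_in" using nf by (simp_all add: normal_form_def)
  have "witness_square choi_matrices (prob (conjugate_by ?W F)) (prob (conjugate_by ?W F')) (square_choi ket \<eta> ket)"
    using square_choi_witness[of ket \<eta> ket] nf
    by (simp add: normal_form_def proj_kron_vec orthonormal_basis_ket)
  from witness_square_conjugate_by[OF unitary_cadjoint[OF U(1)] unitary_cadjoint[OF U(2)] this]
  show ?thesis
    by (auto simp: cadjoint_kron[symmetric] conjugate_by_cadjoint unitary_kron[OF U])
qed

theorem proposition3: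
  fixes F F_perp F' F'_perp :: "complex^(2 \<times> 2)^(2 \<times> 2)"
  assumes "ppovm F F_perp" and "ppovm F' F'_perp"
  shows
    "(maximally_incompatible channels (outcome_prob F) (outcome_prob F') \<longleftrightarrow>
        (\<exists>U_out U_in \<eta>. normal_form U_out U_in \<eta> F F_perp F' F'_perp)) \<and>
     (maximally_incompatible channels (outcome_prob F) (outcome_prob F') \<longrightarrow>
        (\<exists>!x. witness_square channels (outcome_prob F) (outcome_prob F') x)) \<and>
     (\<forall>U_out U_in \<eta> x. normal_form U_out U_in \<eta> F F_perp F' F'_perp \<longrightarrow>
        witness_square channels (outcome_prob F) (outcome_prob F') x \<longrightarrow>
        (\<forall>i j. conjugate_by (kron U_out U_in) (choi (x i j)) =
           kron (proj (ket (i + 1))) (proj (ket 0)) + kron (proj (\<eta> (j + 1))) (proj (ket 1))))"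
proof -
  let ?MI = "maximally_incompatible channels (outcome_prob F) (outcome_prob F')"
  let ?NF = "\<exists>U_out U_in \<eta>. normal_form U_out U_in \<eta> F F_perp F' F'_perp"
  let ?w = "witness_square channels (outcome_prob F) (outcome_prob F')"
  have MI: "?MI \<longleftrightarrow> (\<exists>C. witness_square choi_matrices (prob F) (prob F') C)"
    by (rule maximally_incompatible_iff_choi_witness[OF assms])
  have NF: "?MI \<longleftrightarrow> ?NF"
    unfolding MI using witness_square_imp_normal_form[OF assms] normal_form_imp_witness by blast
  have formula: "conjugate_by (kron U_out U_in) (choi (x i j)) = square_choi ket \<eta> ket i j"
    if "normal_form U_out U_in \<eta> F F_perp F' F'_perp" "?w x" for U_out U_in \<eta> x i j
    using normal_form_witness_eq[OF that(1) choi_witness_square[OF that(2)]] .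
  have "\<exists>!x. ?w x" if mi: ?MI
  proof (rule ex_ex1I)
    show "\<exists>x. ?w x" using mi choi_witness_square_lift unfolding MI by blast
  next
    fix x y assume xy: "?w x" "?w y"
    obtain U_out U_in \<eta> where nf: "normal_form U_out U_in \<eta> F F_perp F' F'_perp"
      using mi NF by blast
    then have W: "unitary (kron U_out U_in)"
      unfolding normal_form_def by (blast intro: unitary_kron)
    \<comment> \<open>Both squares have the same conjugated Choi matrices; undoing the conjugation
      and using injectivity of \<open>choi\<close> on channels identifies them.\<close>
    have "x i j = y i j" for i j
    proof (rule inj_onD[OF inj_on_choi])
      show "choi (x i j) = choi (y i j)"
        using formula[OF nf xy(1)] formula[OF nf xy(2)] by (simp add: conjugate_by_inject[OF W])
    qed (use xy in \<open>simp_all add: witness_square_def\<close>)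
    then show "x = y" by (intro ext)
  qed
  then show ?thesis using NF formula by (simp add: square_choi_def)
qed

end
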